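(* Let $X=\{X_1,\ldots,X_m\}$ be a family of linearly independent smooth vector fields on $\mathbb{R}^n$ satisfying (H.1) and (H.2) (see context), let $\Omega\subseteq\mathbb{R}^n$ be a bounded open set, regular for the Divergence Theorem, and let $\mathcal{F}=\mathcal{F}(x,z,p):\Omega\times\mathbb{R}\times\mathbb{R}^m\to\mathbb{R}$ satisfy (P.1) and (P.2) (see context). Let $u\in C^2(\overline{\Omega})$ be a solution of $$\mathrm{div}_X\big(\mathcal{F}_p(x,u(x),\nabla_Xu(x))\big)+\partial_z\mathcal{F}\big(x,u(x),\nabla_Xu(x)\big)=0\quad\text{in }\Omega .$$ Then $$ \begin{aligned} &\int_{\Omega}\big(q\,\mathcal{F}-\langle \mathcal{F}_p,\nabla_X u\rangle\big)\,dx+\int_{\Omega}\sum_{i=1}^n\sigma_i x_i\,(\partial_{x_i}\mathcal{F})\big(x,u(x),\nabla_X u(x)\big)\,dx\\ &\quad=\int_{\partial\Omega}\mathcal{F}\,\langle \mathrm{T}(x),\nu\rangle\,dH^{n-1}-\int_{\partial\Omega}\mathrm{T}u\,\langle\mathcal{F}_p,\nu_X\rangle\,dH^{n-1}. \end{aligned} $$ If, in addition, $u\equiv0$ on $\partial\Omega$, then for every $a\in\mathbb{R}$ $$ \begin{aligned} &\int_{\Omega}\big(q\,\mathcal{F}-(a+1)\langle \mathcal{F}_p,\nabla_X u\rangle\big)\,dx+\int_{\Omega}\sum_{i=1}^n\sigma_i x_i\,(\partial_{x_i}\mathcal{F})\big(x,u(x),\nabla_X u(x)\big)\,dx-a\int_\Omega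 u\,\partial_z\mathcal{F}\,dx\\ &\quad=\int_{\partial\Omega}\big(\mathcal{F}-\langle\mathcal{F}_p,\nabla_Xu\rangle\big)\,\langle \mathrm{T}(x),\nu\rangle\,dH^{n-1}. \end{aligned} $$ Here $\mathcal{F}$, $\partial_z\mathcal{F}$, $\mathcal{F}_p=(\partial_{p_1}\mathcal{F},\ldots,\partial_{p_m}\mathcal{F})$ are evaluated at $(x,u(x),\nabla_X u(x))$.
   Context: Assumptions on the vector fields. $X_1,\ldots,X_m$ are smooth vector fields on $\mathbb{R}^n$, linearly independent (as elements of the real vector space of smooth vector fields), such that: (H.1) $X_1,\ldots,X_m$ are homogeneous of degree $1$ with respect to a family of dilations $\delta_\lambda(x)=(\lambda^{\sigma_1}x_1,\ldots,\lambda^{\sigma_n}x_n)$, $\lambda>0$, where $\sigma_1,\ldots,\sigma_n\in\mathbb{N}$ and $1=\sigma_1\le\cdots\le\sigma_n$; that is, $X_i(u\circ\delta_\lambda)=\lambda\,(X_iu)\circ\delta_\lambda$ for all $u\in C^\infty(\mathbb{R}^n)$, $\lambda>0$ and $i=1,\ldots,m$. (H.2) Hörmander's condition at $0$: $\dim\{Y(0):Y\in\mathrm{Lie}(X)\}=n$, where $\mathrm{Lie}(X)$ is the smallest Lie subalgebra of the smooth vector fields on $\mathbb{R}^n$ containing $X$. For a vector field $Y=\sum_i a_i(x)\partial_{x_i}$, $Y(x)$ denotes the vector $(a_1(x),\ldots,a_n(x))\in\mathbb{R}^n$. Notation. $q:=\sum_{k=1}^n\sigma_k$. $\mathrm{T}:=\sum_{i=1}^n\sigma_i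 x_i\partial_{x_i}$, so $\mathrm{T}(x)=(\sigma_1x_1,\ldots,\sigma_nx_n)$. $\nabla_Xu=(X_1u,\ldots,X_mu)$. For $V=(V_1,\ldots,V_m)$ of class $C^1$, $\mathrm{div}_XV:=-\sum_{i=1}^mX_iV_i$ (note the minus sign). $H^{n-1}$ is the $(n-1)$-dimensional Hausdorff measure, $\nu$ is the outward unit normal to $\partial\Omega$, and $\nu_X:=(\langle X_1(x),\nu\rangle,\ldots,\langle X_m(x),\nu\rangle)$. "Regular for the Divergence Theorem" has its usual meaning: $H^{n-1}(\partial\Omega)<\infty$, the outward unit normal $\nu$ is defined $H^{n-1}$-a.e. on $\partial\Omega$, and $\int_\Omega\mathrm{div}\,V\,dx=\int_{\partial\Omega}\langle V,\nu\rangle\,dH^{n-1}$ for all $V\in C^1(\overline\Omega;\mathbb{R}^n)$. Assumptions on $\mathcal{F}$, with $\mathcal{D}:=\Omega\times\mathbb{R}\times\mathbb{R}^m$: (P.1) $\mathcal{F}$ is of class $C^1$ on (an open neighborhood of) $\overline{\mathcal{D}}$; (P.2) for every $i=1,\ldots,m$, $\partial_{p_i}\mathcal{F}$ is of class $C^1$ on $\overline{\mathcal{D}}$. *)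

theory Defs
  imports "HOL-Analysis.Analysis"
begin

section \<open>Functions of class C^k\<close>

text \<open>The domain \<open>S\<close> is meant to be open.\<close>

primrec Ck_on :: "nat \<Rightarrow> 'a::euclidean_space set \<Rightarrow> ('a \<Rightarrow> 'b::real_normed_vector) \<Rightarrow> bool" where
  "Ck_on 0 S f \<longleftrightarrow> continuous_on S f"
| "Ck_on (Suc k) S f \<longleftrightarrow> (\<forall>x\<in>S. f differentiable (at x)) \<and>
     (\<forall>v. Ck_on k S (\<lambda>x. frechet_derivative f (at x) v))"

definition smooth :: "('a::euclidean_space \<Rightarrow> 'b::real_normed_vector) \<Rightarrow> bool" where
  "smooth f \<longleftrightarrow> (\<forall>k. Ck_on k UNIV f)"

text \<open>For open \<open>\<Omega>\<close>, \<open>bar_ext \<Omega> f\<close> is \<open>f\<close> on \<open>\<Omega>\<close>, extended to the boundary of \<open>\<Omega>\<close> by its limits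
  from inside \<open>\<Omega>\<close>. It gives boundary values to derivatives that exist only in \<open>\<Omega>\<close>.\<close>

definition bar_ext :: "'a::euclidean_space set \<Rightarrow> ('a \<Rightarrow> 'b::real_normed_vector) \<Rightarrow> 'a \<Rightarrow> 'b" where
  "bar_ext \<Omega> f x = (if x \<in> \<Omega> then f x else Lim (at x within \<Omega>) f)"

text \<open>The space of C^k functions on the closure of an open set \<open>\<Omega>\<close>: all derivatives of order
  at most \<open>k\<close> exist in \<open>\<Omega>\<close> and extend continuously to the closure; \<open>f\<close> itself is required to take
  the extended values on the boundary.\<close>

primrec Ck_bar :: "nat \<Rightarrow> 'a::euclidean_space set \<Rightarrow> ('a \<Rightarrow> 'b::real_normed_vector) \<Rightarrow> bool" where
  "Ck_bar 0 \<Omega> f \<longleftrightarrow> continuous_on (closure \<Omega>) f"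
| "Ck_bar (Suc k) \<Omega> f \<longleftrightarrow> continuous_on (closure \<Omega>) f \<and> (\<forall>x\<in>\<Omega>. f differentiable (at x)) \<and>
     (\<forall>v. Ck_bar k \<Omega> (bar_ext \<Omega> (\<lambda>x. frechet_derivative f (at x) v)))"

section \<open>Vector fields\<close>

text \<open>A vector field is given by its coefficient vector \<open>Y x\<close> at each point \<open>x\<close>.\<close>

type_synonym 'n vfield = "real^'n \<Rightarrow> real^'n"

definition vf_app :: "'n::finite vfield \<Rightarrow> (real^'n \<Rightarrow> real) \<Rightarrow> real^'n \<Rightarrow> real" where
  "vf_app Y f x = frechet_derivative f (at x) (Y x)"

text \<open>The coefficients of the commutator \<open>YZ - ZY\<close>.\<close>

definition lie_bracket :: "'n::finite vfield \<Rightarrow> 'n vfield \<Rightarrow> 'n vfield" where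
  "lie_bracket Y Z x = frechet_derivative Z (at x) (Y x) - frechet_derivative Y (at x) (Z x)"

definition lie_subalgebra :: "'n::finite vfield set \<Rightarrow> bool" where
  "lie_subalgebra L \<longleftrightarrow> (\<forall>Y\<in>L. smooth Y) \<and> (\<lambda>x. 0) \<in> L \<and>
     (\<forall>Y\<in>L. \<forall>Z\<in>L. (\<lambda>x. Y x + Z x) \<in> L) \<and>
     (\<forall>c. \<forall>Y\<in>L. (\<lambda>x. c *\<^sub>R Y x) \<in> L) \<and>
     (\<forall>Y\<in>L. \<forall>Z\<in>L. lie_bracket Y Z \<in> L)"

definition lin_indep_fields :: "('m::finite \<Rightarrow> 'n::finite vfield) \<Rightarrow> bool" where
  "lin_indep_fields X \<longleftrightarrow>
     (\<forall>c::'m \<Rightarrow> real. (\<lambda>x. \<Sum>i\<in>UNIV. c i *\<^sub>R X i x) = (\<lambda>x. 0) \<longrightarrow> (\<forall>i. c i = 0))"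

definition dil_weights :: "('n::{finite,linorder} \<Rightarrow> nat) \<Rightarrow> bool" where
  "dil_weights \<sigma> \<longleftrightarrow> mono \<sigma> \<and> \<sigma> (Min UNIV) = 1"

definition dil :: "('n::finite \<Rightarrow> nat) \<Rightarrow> real \<Rightarrow> real^'n \<Rightarrow> real^'n" where
  "dil \<sigma> t x = (\<chi> j. t ^ \<sigma> j * x $ j)"

definition homogeneous_deg1 :: "('n::finite \<Rightarrow> nat) \<Rightarrow> 'n vfield \<Rightarrow> bool" where
  "homogeneous_deg1 \<sigma> Y \<longleftrightarrow> (\<forall>f t. smooth f \<longrightarrow> 0 < t \<longrightarrow>
     vf_app Y (f \<circ> dil \<sigma> t) = (\<lambda>x. t * vf_app Y f (dil \<sigma> t x)))"

definition hoermander_at_0 :: "('m::finite \<Rightarrow> 'n::finite vfield) \<Rightarrow> bool" where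
  "hoermander_at_0 X \<longleftrightarrow> dim ((\<lambda>Y. Y 0) ` (lie_subalgebra hull (range X))) = CARD('n)"

definition T_field :: "('n::finite \<Rightarrow> nat) \<Rightarrow> 'n vfield" where
  "T_field \<sigma> x = (\<chi> j. real (\<sigma> j) * x $ j)"

definition X_grad :: "('m::finite \<Rightarrow> 'n::finite vfield) \<Rightarrow> (real^'n \<Rightarrow> real) \<Rightarrow> real^'n \<Rightarrow> real^'m" where
  "X_grad X f x = (\<chi> i. vf_app (X i) f x)"

text \<open>The minus sign makes this the formal adjoint of \<^term>\<open>X_grad X\<close> when the fields are homogeneous of degree 1,
  because then the formal adjoint of each \<open>X i\<close> is its negative.\<close>

definition X_div :: "('m::finite \<Rightarrow> 'n::finite vfield) \<Rightarrow> (real^'n \<Rightarrow> real^'m) \<Rightarrow> real^'n \<Rightarrow> real" where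
  "X_div X V x = - (\<Sum>i\<in>UNIV. vf_app (X i) (\<lambda>y. V y $ i) x)"

section \<open>Hausdorff measure and domains regular for the Divergence Theorem\<close>

text \<open>Normalised so that the \<open>k\<close>-dimensional measure agrees with surface measure. Covering sets
  must be bounded because \<^term>\<open>diameter\<close> is meaningless on unbounded sets, and
  the empty set must cost nothing also for \<open>k = 0\<close>, where \<open>0 ^ 0 = 1\<close>.\<close>

definition hausdorff_pre :: "nat \<Rightarrow> real \<Rightarrow> 'a::euclidean_space set \<Rightarrow> ennreal" where
  "hausdorff_pre k \<delta> A =
     (INF C \<in> {C :: nat \<Rightarrow> 'a set. A \<subseteq> (\<Union>i. C i) \<and> (\<forall>i. bounded (C i) \<and> diameter (C i) \<le> \<delta>)}.
        \<Sum>i. if C i = {} then 0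
            else ennreal (unit_ball_vol (real k) * (diameter (C i) / 2) ^ k))"

definition hausdorff_outer :: "nat \<Rightarrow> 'a::euclidean_space set \<Rightarrow> ennreal" where
  "hausdorff_outer k A = (SUP \<delta> \<in> {0<..}. hausdorff_pre k \<delta> A)"

text \<open>The metric outer measure \<^const>\<open>hausdorff_outer\<close> is countably additive on the Borel sets by
  Caratheodory's criterion, so \<^const>\<open>measure_of\<close> yields its restriction to them.\<close>

definition hausdorff :: "nat \<Rightarrow> 'a::euclidean_space measure" where
  "hausdorff k = measure_of UNIV (sets borel) (hausdorff_outer k)"

text \<open>The exterior unit normal in Federer's sense, a pointwise notion that makes sense at boundary
  points of an arbitrary open set: in the density limit at \<open>x\<close>, \<open>\<Omega>\<close> fills the half-space
  \<open>(y - x) \<bullet> \<nu> < 0\<close> and misses the half-space \<open>(y - x) \<bullet> \<nu> > 0\<close>. There is at most one such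
  vector, and it is the classical outward normal wherever the boundary is a hypersurface of class
  C^1 with \<open>\<Omega>\<close> on one side.\<close>

definition outward_unit_normal :: "(real^'n::finite) set \<Rightarrow> real^'n \<Rightarrow> real^'n \<Rightarrow> bool" where
  "outward_unit_normal \<Omega> x n \<longleftrightarrow> norm n = 1 \<and>
     ((\<lambda>r. measure lborel {y \<in> ball x r \<inter> \<Omega>. (y - x) \<bullet> n > 0} / r ^ CARD('n)) \<longlongrightarrow> 0) (at_right 0) \<and>
     ((\<lambda>r. measure lborel {y \<in> ball x r - \<Omega>. (y - x) \<bullet> n < 0} / r ^ CARD('n)) \<longlongrightarrow> 0) (at_right 0)"

definition divg :: "(real^'n::finite \<Rightarrow> real^'n) \<Rightarrow> real^'n \<Rightarrow> real" where
  "divg V x = (\<Sum>j\<in>UNIV. frechet_derivative V (at x) (axis j 1) $ j)"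

definition surf :: "(real^'n::finite) measure" where
  "surf = hausdorff (CARD('n) - 1)"

text \<open>The field \<open>\<nu>\<close> is any measurable representative of the almost everywhere defined outward
  normal; its values off the boundary are irrelevant.\<close>

definition divergence_regular :: "(real^'n::finite) set \<Rightarrow> (real^'n \<Rightarrow> real^'n) \<Rightarrow> bool" where
  "divergence_regular \<Omega> \<nu> \<longleftrightarrow>
     emeasure surf (frontier \<Omega>) < \<infinity> \<and>
     set_borel_measurable surf (frontier \<Omega>) \<nu> \<and>
     (AE x in surf. x \<in> frontier \<Omega> \<longrightarrow> outward_unit_normal \<Omega> x (\<nu> x)) \<and>
     (\<forall>V. Ck_bar 1 \<Omega> V \<longrightarrow>
        (LINT x:\<Omega>|lborel. divg V x) = (LINT x:frontier \<Omega>|surf. V x \<bullet> \<nu> x))"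

section \<open>The integrand\<close>

definition D_x :: "((real^'n::finite) \<times> real \<times> (real^'m::finite) \<Rightarrow> real) \<Rightarrow> 'n \<Rightarrow>
    (real^'n) \<times> real \<times> (real^'m) \<Rightarrow> real" where
  "D_x F j w = frechet_derivative F (at w) (axis j 1, 0, 0)"

definition D_z :: "((real^'n::finite) \<times> real \<times> (real^'m::finite) \<Rightarrow> real) \<Rightarrow>
    (real^'n) \<times> real \<times> (real^'m) \<Rightarrow> real" where
  "D_z F w = frechet_derivative F (at w) (0, 1, 0)"

definition D_p :: "((real^'n::finite) \<times> real \<times> (real^'m::finite) \<Rightarrow> real) \<Rightarrow>
    (real^'n) \<times> real \<times> (real^'m) \<Rightarrow> real^'m" where
  "D_p F w = (\<chi> i. frechet_derivative F (at w) (0, 0, axis i 1))"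

definition P1 :: "(real^'n::finite) set \<Rightarrow> ((real^'n) \<times> real \<times> (real^'m::finite) \<Rightarrow> real) \<Rightarrow> bool" where
  "P1 \<Omega> F \<longleftrightarrow> (\<exists>W. open W \<and> closure (\<Omega> \<times> UNIV \<times> UNIV) \<subseteq> W \<and> Ck_on 1 W F)"

definition P2 :: "(real^'n::finite) set \<Rightarrow> ((real^'n) \<times> real \<times> (real^'m::finite) \<Rightarrow> real) \<Rightarrow> bool" where
  "P2 \<Omega> F \<longleftrightarrow> (\<forall>i. Ck_bar 1 (\<Omega> \<times> UNIV \<times> UNIV) (\<lambda>w. D_p F w $ i))"

text \<open>The point \<open>(x, u(x), \<nabla>\<^sub>X u(x))\<close> at which the integrand is evaluated, for \<open>x\<close> in the closure
  of \<open>\<Omega>\<close>.\<close>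

definition jet :: "('m::finite \<Rightarrow> 'n::finite vfield) \<Rightarrow> (real^'n) set \<Rightarrow> (real^'n \<Rightarrow> real) \<Rightarrow>
    real^'n \<Rightarrow> (real^'n) \<times> real \<times> (real^'m)" where
  "jet X \<Omega> u x = (x, u x, bar_ext \<Omega> (X_grad X u) x)"

end

theory Submission
  imports Defs
begin

text \<open>Write \<open>T\<close> for \<^term>\<open>T_field \<sigma>\<close> and \<open>J\<close> for the jet \<open>(x, u, \<nabla>\<^sub>X u)\<close>, and set
  \<open>Y = \<Sum>\<^sub>i (D_p F)\<^sub>i(J) X\<^sub>i\<close>. The first identity is the Divergence Theorem for the field
  \<open>F(J) T - (T u) Y\<close>, whose divergence is
  \<open>q F - \<langle>D_p F, \<nabla>\<^sub>X u\<rangle> + \<Sum>\<^sub>j \<sigma>\<^sub>j x\<^sub>j \<partial>\<^sub>jF\<close>. Two consequences of homogeneity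
  are behind this: every \<open>X\<^sub>i\<close> is divergence free (\<open>homogeneous_deg1_diagonal_zero\<close>), so that the
  equation for \<open>u\<close> reads \<open>div Y = \<partial>\<^sub>zF\<close>, and \<open>X\<^sub>i T - T X\<^sub>i = X\<^sub>i\<close>
  (\<open>homogeneous_deg1_T_derivative\<close>), so that the derivatives of \<open>\<nabla>\<^sub>X u\<close> along \<open>T\<close> cancel against the
  derivatives of \<open>T u\<close> along the \<open>X\<^sub>i\<close>, except for the term \<open>- \<langle>D_p F, \<nabla>\<^sub>X u\<rangle>\<close>.

  If \<open>u\<close> vanishes on the boundary, the Divergence Theorem for \<open>u Y\<close> gives
  \<open>\<integral> \<langle>D_p F, \<nabla>\<^sub>X u\<rangle> + u \<partial>\<^sub>zF = 0\<close>, and \<open>a\<close> times this may be subtracted. It remains to replace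
  \<open>T u \<langle>Y, \<nu>\<rangle>\<close> by \<open>Y u \<langle>T, \<nu>\<rangle>\<close> on the boundary. For a smooth boundary this holds because the gradient
  of \<open>u\<close> is normal to it. For a domain that is merely regular for the Divergence Theorem, the
  tangential components \<open>\<partial>\<^sub>ju \<nu>\<^sub>k - \<partial>\<^sub>ku \<nu>\<^sub>j\<close> are shown to have integral zero against polynomials, by
  the Divergence Theorem once more, and then against continuous functions by the Stone-Weierstrass
  theorem (\<open>tangential_gradient_zero\<close>); this weak statement is all that is needed
  (\<open>normal_exchange\<close>).\<close>

section \<open>Functions of class C^1 on the closure, with their gradient\<close>

text \<open>The function \<open>f\<close> is continuous on the closure of \<open>\<Omega>\<close> and differentiable in \<open>\<Omega>\<close>, and \<open>g\<close>
  is its gradient in \<open>\<Omega>\<close>, together with the continuous extension of the gradient to the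
  boundary. Naming the extended gradient replaces \<^const>\<open>bar_ext\<close> by explicit formulas that obey
  the usual calculus rules.\<close>

definition C1_bar_grad :: "'a::euclidean_space set \<Rightarrow> ('a \<Rightarrow> real) \<Rightarrow> ('a \<Rightarrow> 'a) \<Rightarrow> bool" where
  "C1_bar_grad \<Omega> f g \<longleftrightarrow> continuous_on (closure \<Omega>) f \<and> continuous_on (closure \<Omega>) g \<and>
     (\<forall>x\<in>\<Omega>. (f has_derivative (\<lambda>v. g x \<bullet> v)) (at x))"

lemma bar_ext_eq:
  assumes "continuous_on (closure \<Omega>) g" and "\<And>x. x \<in> \<Omega> \<Longrightarrow> f x = g x" and "x \<in> closure \<Omega>"
  shows "bar_ext \<Omega> f x = g x"
proof (cases "x \<in> \<Omega>")
  case True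
  then show ?thesis by (simp add: bar_ext_def assms(2))
next
  case False
  then have lp: "x islimpt \<Omega>" using assms(3) by (simp add: closure_def)
  have "(g \<longlongrightarrow> g x) (at x within closure \<Omega>)"
    using assms(1,3) by (simp add: continuous_on_def)
  then have "(g \<longlongrightarrow> g x) (at x within \<Omega>)"
    by (rule tendsto_within_subset) (rule closure_subset)
  then have "(f \<longlongrightarrow> g x) (at x within \<Omega>)"
    by (rule Lim_transform_eventually) (simp add: eventually_at_filter assms(2))
  then have "Lim (at x within \<Omega>) f = g x"
    by (intro tendsto_Lim) (simp_all add: lp trivial_limit_within)
  then show ?thesis using False by (simp add: bar_ext_def)
qed

lemma continuous_on_bar_ext:
  assumes "continuous_on (closure \<Omega>) g" and "\<And>x. x \<in> \<Omega> \<Longrightarrow> f x = g x"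
  shows "continuous_on (closure \<Omega>) (bar_ext \<Omega> f)"
  using assms(1) bar_ext_eq[OF assms] by (simp cong: continuous_on_cong)

lemma inner_sum_Basis_linear:
  assumes "linear L"
  shows "(\<Sum>b\<in>Basis. L b *\<^sub>R b) \<bullet> v = (L v :: real)"
proof -
  have "L v = L (\<Sum>b\<in>Basis. (v \<bullet> b) *\<^sub>R b)" by (simp add: euclidean_representation)
  also have "\<dots> = (\<Sum>b\<in>Basis. (v \<bullet> b) * L b)"
    by (simp add: linear_sum[OF assms] linear_scale[OF assms])
  finally show ?thesis
    by (simp add: inner_sum_left inner_commute[of v] mult.commute)
qed

lemma Ck_bar_1_imp_C1_bar_grad:
  assumes "Ck_bar 1 \<Omega> f"
  shows "C1_bar_grad \<Omega> f (\<lambda>x. \<Sum>b\<in>Basis. bar_ext \<Omega> (\<lambda>y. frechet_derivative f (at y) b) x *\<^sub>R b)"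
proof -
  have 1: "continuous_on (closure \<Omega>) f" "\<And>x. x \<in> \<Omega> \<Longrightarrow> f differentiable (at x)"
    "\<And>v. continuous_on (closure \<Omega>) (bar_ext \<Omega> (\<lambda>x. frechet_derivative f (at x) v))"
    using assms by (simp_all add: One_nat_def)
  have "(f has_derivative (\<lambda>v. (\<Sum>b\<in>Basis. bar_ext \<Omega> (\<lambda>y. frechet_derivative f (at y) b) x *\<^sub>R b) \<bullet> v)) (at x)"
    if "x \<in> \<Omega>" for x
  proof -
    have fd: "(f has_derivative frechet_derivative f (at x)) (at x)"
      using 1(2)[OF that] by (simp add: frechet_derivative_works)
    then have "linear (frechet_derivative f (at x))" by (rule has_derivative_linear)
    from inner_sum_Basis_linear[OF this] fd show ?thesis
      using that by (simp add: bar_ext_def)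
  qed
  then show ?thesis unfolding C1_bar_grad_def
    by (intro conjI ballI 1 continuous_intros)
qed

lemma C1_bar_grad_cong:
  assumes "open \<Omega>" "C1_bar_grad \<Omega> f g" "\<And>x. x \<in> closure \<Omega> \<Longrightarrow> f x = f' x" "\<And>x. x \<in> closure \<Omega> \<Longrightarrow> g x = g' x"
  shows "C1_bar_grad \<Omega> f' g'"
proof -
  have "(f' has_derivative (\<lambda>v. g' x \<bullet> v)) (at x)" if "x \<in> \<Omega>" for x
  proof -
    have sub: "y \<in> closure \<Omega>" if "y \<in> \<Omega>" for y using that closure_subset by blast
    have "(f has_derivative (\<lambda>v. g' x \<bullet> v)) (at x)"
      using assms(2,4) that sub by (simp add: C1_bar_grad_def)
    then show ?thesis
      by (rule has_derivative_transform_within_open[OF _ assms(1) that]) (simp add: assms(3) sub)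
  qed
  then show ?thesis using assms
    by (simp add: C1_bar_grad_def cong: continuous_on_cong)
qed

lemma C1_bar_grad_subset:
  assumes "C1_bar_grad \<Omega>' f g" "\<Omega> \<subseteq> \<Omega>'"
  shows "C1_bar_grad \<Omega> f g"
  using assms closure_mono[OF assms(2)] unfolding C1_bar_grad_def
  by (auto intro: continuous_on_subset)

lemma C1_bar_grad_add:
  "C1_bar_grad \<Omega> f g \<Longrightarrow> C1_bar_grad \<Omega> f' g' \<Longrightarrow> C1_bar_grad \<Omega> (\<lambda>x. f x + f' x) (\<lambda>x. g x + g' x)"
  unfolding C1_bar_grad_def
  by (auto intro!: continuous_intros derivative_eq_intros simp: inner_add_left)

lemma C1_bar_grad_mult:
  "C1_bar_grad \<Omega> f g \<Longrightarrow> C1_bar_grad \<Omega> f' g' \<Longrightarrow>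
    C1_bar_grad \<Omega> (\<lambda>x. f x * f' x) (\<lambda>x. f x *\<^sub>R g' x + f' x *\<^sub>R g x)"
  unfolding C1_bar_grad_def
  by (auto intro!: continuous_intros derivative_eq_intros simp: inner_add_left algebra_simps)

lemma C1_bar_grad_inner_const: "C1_bar_grad \<Omega> (\<lambda>x. c \<bullet> x) (\<lambda>x. c)"
  unfolding C1_bar_grad_def
  by (auto intro!: continuous_intros derivative_eq_intros)

lemma C1_bar_grad_const: "C1_bar_grad \<Omega> (\<lambda>x. c) (\<lambda>x. 0)"
  unfolding C1_bar_grad_def
  by (auto intro!: continuous_intros derivative_eq_intros)

lemma C1_bar_grad_sum:
  assumes "finite I" "\<And>i. i \<in> I \<Longrightarrow> C1_bar_grad \<Omega> (f i) (g i)"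
  shows "C1_bar_grad \<Omega> (\<lambda>x. \<Sum>i\<in>I. f i x) (\<lambda>x. \<Sum>i\<in>I. g i x)"
  using assms
  by (induction I rule: finite_induct) (simp_all add: C1_bar_grad_const C1_bar_grad_add)

lemma has_derivative_vec_lambda_grad:
  fixes V :: "'a::real_inner \<Rightarrow> real^'n"
  assumes "\<And>j. ((\<lambda>x. V x $ j) has_derivative (\<lambda>v. G j \<bullet> v)) (at x)"
  shows "(V has_derivative (\<lambda>v. \<chi> j. G j \<bullet> v)) (at x)"
  unfolding has_derivative_componentwise_within[of V]
  using assms by (auto simp: Basis_vec_def inner_axis)

lemma Ck_bar_1_vector:
  fixes V :: "real^'n::finite \<Rightarrow> real^'n"
  assumes V: "\<And>j. C1_bar_grad \<Omega> (\<lambda>x. V x $ j) (G j)"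
  shows "Ck_bar 1 \<Omega> V" and "\<And>x. x \<in> \<Omega> \<Longrightarrow> divg V x = (\<Sum>j\<in>UNIV. G j x $ j)"
proof -
  have d: "(V has_derivative (\<lambda>v. \<chi> j. G j x \<bullet> v)) (at x)" if "x \<in> \<Omega>" for x
    using V that by (intro has_derivative_vec_lambda_grad) (simp add: C1_bar_grad_def)
  then have fd: "frechet_derivative V (at x) = (\<lambda>v. \<chi> j. G j x \<bullet> v)" if "x \<in> \<Omega>" for x
    using that frechet_derivative_at by metis
  have "continuous_on (closure \<Omega>) (\<lambda>x. \<chi> j. V x $ j)"
    using V by (intro continuous_on_vec_lambda) (simp add: C1_bar_grad_def)
  then have c: "continuous_on (closure \<Omega>) V" by simp
  have "continuous_on (closure \<Omega>) (\<lambda>x. \<chi> j. G j x \<bullet> v)" for v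
    using V by (intro continuous_on_vec_lambda continuous_intros) (simp add: C1_bar_grad_def)
  then have "continuous_on (closure \<Omega>) (bar_ext \<Omega> (\<lambda>x. frechet_derivative V (at x) v))" for v
    by (rule continuous_on_bar_ext) (simp add: fd)
  then show "Ck_bar 1 \<Omega> V"
    using c d by (auto simp: One_nat_def differentiable_def)
  show "divg V x = (\<Sum>j\<in>UNIV. G j x $ j)" if "x \<in> \<Omega>" for x
    using that by (simp add: divg_def fd inner_axis)
qed

section \<open>Symmetry of second derivatives\<close>

lemma has_derivative_gradient_compose:
  assumes "(\<phi> has_derivative \<phi>') (at s)" "(f has_derivative (\<lambda>h. G \<bullet> h)) (at (\<phi> s))"
  shows "((\<lambda>s. f (\<phi> s)) has_derivative (\<lambda>h. G \<bullet> \<phi>' h)) (at s)"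
  using assms by (rule has_derivative_compose)

text \<open>Two applications of the mean value theorem, first along \<open>v\<close> and then along \<open>w\<close>.
  The second difference on the left is symmetric in \<open>v\<close> and \<open>w\<close>.\<close>

lemma second_difference_eq:
  fixes f :: "'a::real_inner \<Rightarrow> real"
  assumes sub: "ball x r \<subseteq> S" and t: "0 < t" "t * (norm v + norm w) < r"
    and f: "\<And>y. y \<in> S \<Longrightarrow> (f has_derivative (\<lambda>h. g y \<bullet> h)) (at y)"
    and g: "\<And>y. y \<in> S \<Longrightarrow> ((\<lambda>y. g y \<bullet> v) has_derivative (\<lambda>h. a y \<bullet> h)) (at y)"
  shows "\<exists>y. dist x y \<le> t * (norm v + norm w) \<and>
     f (x + t *\<^sub>R v + t *\<^sub>R w) - f (x + t *\<^sub>R v) - f (x + t *\<^sub>R w) + f x = t * (t * (a y \<bullet> w))"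
proof -
  have near: "dist x (x + s *\<^sub>R v + q *\<^sub>R w) \<le> t * (norm v + norm w)"
    if "0 \<le> s" "s \<le> t" "0 \<le> q" "q \<le> t" for s q
  proof -
    have "norm (s *\<^sub>R v + q *\<^sub>R w) \<le> s * norm v + q * norm w"
      using norm_triangle_ineq[of "s *\<^sub>R v" "q *\<^sub>R w"] that by simp
    also have "\<dots> \<le> t * norm v + t * norm w"
      using that by (intro add_mono mult_right_mono) auto
    also have "norm (s *\<^sub>R v + q *\<^sub>R w) = dist x (x + s *\<^sub>R v + q *\<^sub>R w)"
      by (subst dist_commute) (simp add: dist_norm add.assoc)
    finally show ?thesis by (simp add: algebra_simps)
  qed
  have inS: "x + s *\<^sub>R v + q *\<^sub>R w \<in> S"
    if "0 \<le> s" "s \<le> t" "0 \<le> q" "q \<le> t" for s q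
    using near[OF that] t sub by (auto simp: subset_iff)
  define \<phi> where "\<phi> s = f (x + s *\<^sub>R v + t *\<^sub>R w) - f (x + s *\<^sub>R v)" for s
  have fc: "((\<lambda>s. f (x + s *\<^sub>R v + q *\<^sub>R w)) has_derivative
     (\<lambda>h. g (x + s *\<^sub>R v + q *\<^sub>R w) \<bullet> (h *\<^sub>R v))) (at s)"
    if "0 \<le> s" "s \<le> t" "0 \<le> q" "q \<le> t" for s q
    by (rule has_derivative_gradient_compose[where f = f])
       (auto intro!: derivative_eq_intros f inS that)
  have "\<exists>s\<in>{0<..<t}. \<phi> t - \<phi> 0 = (\<lambda>h. g (x + s *\<^sub>R v + t *\<^sub>R w) \<bullet> (h *\<^sub>R v) - g (x + s *\<^sub>R v) \<bullet> (h *\<^sub>R v)) (t - 0)"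
    unfolding \<phi>_def using t(1)
    by (intro mvt_simple has_derivative_diff)
      (use fc[of _ t] fc[of _ 0] in \<open>auto intro: has_derivative_at_withinI\<close>)
  then obtain s where s: "0 < s" "s < t"
    and e1: "\<phi> t - \<phi> 0 = t * (g (x + s *\<^sub>R v + t *\<^sub>R w) \<bullet> v - g (x + s *\<^sub>R v) \<bullet> v)"
    by (auto simp: algebra_simps)
  have gc: "((\<lambda>q. g (x + s *\<^sub>R v + q *\<^sub>R w) \<bullet> v) has_derivative
     (\<lambda>h. a (x + s *\<^sub>R v + q *\<^sub>R w) \<bullet> (h *\<^sub>R w))) (at q)"
    if "0 \<le> q" "q \<le> t" for q
    by (rule has_derivative_gradient_compose[where f = "\<lambda>y. g y \<bullet> v"])
       (use s that in \<open>auto intro!: derivative_eq_intros g inS\<close>)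
  have "\<exists>q\<in>{0<..<t}. g (x + s *\<^sub>R v + t *\<^sub>R w) \<bullet> v - g (x + s *\<^sub>R v + 0 *\<^sub>R w) \<bullet> v
     = (\<lambda>h. a (x + s *\<^sub>R v + q *\<^sub>R w) \<bullet> (h *\<^sub>R w)) (t - 0)"
    using t(1)
    by (intro mvt_simple) (use gc in \<open>auto intro: has_derivative_at_withinI\<close>)
  then obtain q where q: "0 < q" "q < t"
    and e2: "g (x + s *\<^sub>R v + t *\<^sub>R w) \<bullet> v - g (x + s *\<^sub>R v) \<bullet> v = t * (a (x + s *\<^sub>R v + q *\<^sub>R w) \<bullet> w)"
    by auto
  have "\<phi> t - \<phi> 0 = t * (t * (a (x + s *\<^sub>R v + q *\<^sub>R w) \<bullet> w))"
    using e1 e2 by simp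
  then show ?thesis using near[of s q] s q
    by (intro exI[of _ "x + s *\<^sub>R v + q *\<^sub>R w"]) (auto simp: \<phi>_def)
qed

lemma second_derivative_symmetric:
  fixes f :: "'a::real_inner \<Rightarrow> real"
  assumes S: "open S" "x \<in> S"
    and f: "\<And>y. y \<in> S \<Longrightarrow> (f has_derivative (\<lambda>h. g y \<bullet> h)) (at y)"
    and a: "\<And>y. y \<in> S \<Longrightarrow> ((\<lambda>y. g y \<bullet> v) has_derivative (\<lambda>h. a y \<bullet> h)) (at y)" "continuous_on S a"
    and b: "\<And>y. y \<in> S \<Longrightarrow> ((\<lambda>y. g y \<bullet> w) has_derivative (\<lambda>h. b y \<bullet> h)) (at y)" "continuous_on S b"
  shows "a x \<bullet> w = b x \<bullet> v"
proof -
  \<comment> \<open>Evaluating one second difference in the two possible orders gives points \<open>y n\<close>, \<open>z n\<close>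
    tending to \<open>x\<close> at which the two mixed derivatives agree.\<close>
  obtain r where r: "r > 0" "ball x r \<subseteq> S" using S open_contains_ball by blast
  define K where "K = norm v + norm w + 1"
  have K: "K > 0" unfolding K_def by (smt (verit) norm_ge_zero)
  have "\<exists>y z. dist x y \<le> r / 2 / (real n + 1) \<and> dist x z \<le> r / 2 / (real n + 1) \<and> a y \<bullet> w = b z \<bullet> v" for n
  proof -
    define t where "t = r / 2 / (real n + 1) / K"
    have t: "t > 0" using r K by (simp add: t_def)
    have "t * (norm v + norm w) \<le> t * K" using t by (simp add: K_def)
    also have tK: "\<dots> = r / 2 / (real n + 1)" using K by (simp add: t_def)
    finally have t1: "t * (norm v + norm w) \<le> r / 2 / (real n + 1)" .
    have "r / 2 / (real n + 1) < r" using r by (simp add: field_simps add_pos_nonneg)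
    with t1 have t2: "t * (norm v + norm w) < r" "t * (norm w + norm v) < r" by (auto simp: algebra_simps)
    obtain y where y: "dist x y \<le> t * (norm v + norm w)"
      "f (x + t *\<^sub>R v + t *\<^sub>R w) - f (x + t *\<^sub>R v) - f (x + t *\<^sub>R w) + f x = t * (t * (a y \<bullet> w))"
      using second_difference_eq[OF r(2) t t2(1) f a(1)] by blast
    obtain z where z: "dist x z \<le> t * (norm w + norm v)"
      "f (x + t *\<^sub>R w + t *\<^sub>R v) - f (x + t *\<^sub>R w) - f (x + t *\<^sub>R v) + f x = t * (t * (b z \<bullet> v))"
      using second_difference_eq[OF r(2) t t2(2) f b(1)] by blast
    have "x + t *\<^sub>R v + t *\<^sub>R w = x + t *\<^sub>R w + t *\<^sub>R v" by (simp add: algebra_simps)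
    then have "t * (t * (a y \<bullet> w)) = t * (t * (b z \<bullet> v))"
      unfolding y(2)[symmetric] z(2)[symmetric] by (simp add: algebra_simps)
    then have "a y \<bullet> w = b z \<bullet> v" using t by simp
    then show ?thesis using y z t1 by (metis add.commute order_trans)
  qed
  then obtain y z where yz: "\<And>n. dist x (y n) \<le> r / 2 / (real n + 1)"
    "\<And>n. dist x (z n) \<le> r / 2 / (real n + 1)" "\<And>n. a (y n) \<bullet> w = b (z n) \<bullet> v" by metis
  have lim0: "(\<lambda>n. r / 2 / (real n + 1)) \<longlonglongrightarrow> 0"
    using LIMSEQ_Suc[OF tendsto_divide_0[OF tendsto_const[of "r/2"] filterlim_at_top_imp_at_infinity[OF filterlim_real_sequentially]]]
    by (simp add: add.commute)
  have lim: "p \<longlonglongrightarrow> x" if "\<And>n. dist x (p n) \<le> r / 2 / (real n + 1)" for p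
    by (rule metric_tendsto_imp_tendsto[OF lim0])
      (use that r in \<open>auto simp: dist_commute dist_real_def intro!: always_eventually\<close>)
  have "isCont a x" "isCont b x" using a b S continuous_on_eq_continuous_at by blast+
  then have "(\<lambda>n. a (y n) \<bullet> w) \<longlonglongrightarrow> a x \<bullet> w" "(\<lambda>n. b (z n) \<bullet> v) \<longlonglongrightarrow> b x \<bullet> v"
    using lim[OF yz(1)] lim[OF yz(2)] by (auto intro!: tendsto_intros intro: isCont_tendsto_compose)
  then show ?thesis using yz(3) by (simp add: LIMSEQ_unique)
qed

section \<open>Homogeneous vector fields\<close>

lemma frechet_derivative_linear_eq:
  "bounded_linear f \<Longrightarrow> frechet_derivative f (at x) = f"
  using bounded_linear_imp_has_derivative frechet_derivative_at by metis

lemma Ck_on_const: "Ck_on k S (\<lambda>x. c)"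
  by (induction k arbitrary: c) simp_all

lemma smooth_component: "smooth (\<lambda>x::real^'n::finite. x $ j)"
  unfolding smooth_def
proof
  fix k
  have bl: "bounded_linear (\<lambda>x::real^'n. x $ j)" by (rule bounded_linear_vec_nth)
  show "Ck_on k UNIV (\<lambda>x::real^'n. x $ j)"
  proof (cases k)
    case 0
    then show ?thesis by (simp add: continuous_intros)
  next
    case (Suc k')
    then show ?thesis
      by (simp add: frechet_derivative_linear_eq[OF bl] Ck_on_const bounded_linear_imp_differentiable[OF bl])
  qed
qed

text \<open>Homogeneity tested on the coordinate function \<open>x \<mapsto> x $ j\<close>.\<close>

lemma homogeneous_deg1_component:
  fixes Y :: "'n::finite vfield"
  assumes "homogeneous_deg1 \<sigma> Y" "0 < t"
  shows "t ^ \<sigma> j * Y x $ j = t * Y (dil \<sigma> t x) $ j"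
proof -
  have bl: "bounded_linear (\<lambda>x::real^'n. x $ j)" by (rule bounded_linear_vec_nth)
  have bl2: "bounded_linear (\<lambda>x::real^'n. t ^ \<sigma> j * x $ j)"
    by (intro bounded_linear_const_mult bounded_linear_vec_nth)
  have "vf_app Y ((\<lambda>x. x $ j) \<circ> dil \<sigma> t) = (\<lambda>x. t * vf_app Y (\<lambda>x. x $ j) (dil \<sigma> t x))"
    using assms smooth_component unfolding homogeneous_deg1_def by blast
  then have "vf_app Y ((\<lambda>x. x $ j) \<circ> dil \<sigma> t) x = t * vf_app Y (\<lambda>x. x $ j) (dil \<sigma> t x)"
    by (rule fun_cong)
  moreover have "(\<lambda>x. x $ j) \<circ> dil \<sigma> t = (\<lambda>x::real^'n. t ^ \<sigma> j * x $ j)"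
    by (simp add: dil_def fun_eq_iff)
  ultimately show ?thesis
    by (simp add: vf_app_def frechet_derivative_linear_eq[OF bl] frechet_derivative_linear_eq[OF bl2])
qed

lemma smooth_imp_C1_bar_grad:
  fixes Y :: "'n::finite vfield"
  assumes "smooth Y"
  shows "\<exists>A. \<forall>k. C1_bar_grad UNIV (\<lambda>x. Y x $ k) (A k)"
proof (intro exI allI)
  fix k
  have "Ck_on 1 UNIV Y" using assms by (simp add: smooth_def)
  then have d: "\<And>x. Y differentiable (at x)"
    and c: "\<And>v. continuous_on UNIV (\<lambda>x. frechet_derivative Y (at x) v)"
    by (auto simp: One_nat_def)
  have dk: "((\<lambda>x. Y x $ k) has_derivative (\<lambda>v. frechet_derivative Y (at x) v $ k)) (at x)" for x
    using d[of x] bounded_linear.has_derivative[OF bounded_linear_vec_nth]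
    by (metis frechet_derivative_works)
  have "((\<lambda>x. Y x $ k) has_derivative (\<lambda>v. (\<Sum>b\<in>Basis. (frechet_derivative Y (at x) b $ k) *\<^sub>R b) \<bullet> v)) (at x)" for x
    using inner_sum_Basis_linear[OF has_derivative_linear[OF dk]] dk[of x] by simp
  moreover have "continuous_on UNIV (\<lambda>x. Y x $ k)"
    by (rule has_derivative_continuous_on) (rule has_derivative_at_withinI[OF dk])
  ultimately show "C1_bar_grad UNIV (\<lambda>x. Y x $ k)
      (\<lambda>x. \<Sum>b\<in>Basis. (frechet_derivative Y (at x) b $ k) *\<^sub>R b)"
    unfolding C1_bar_grad_def by (auto intro!: continuous_intros c)
qed

text \<open>Euler's relation for the components of \<open>Y\<close>, obtained by differentiating
  \<open>homogeneous_deg1_component\<close> in \<open>t\<close> at \<open>t = 1\<close>. It expresses that the commutator of \<open>Y\<close>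
  with \<open>T_field \<sigma>\<close> is \<open>Y\<close> itself.\<close>

lemma homogeneous_deg1_T_derivative:
  fixes Y :: "'n::finite vfield"
  assumes hom: "homogeneous_deg1 \<sigma> Y" and A: "C1_bar_grad UNIV (\<lambda>x. Y x $ k) (A k)"
  shows "A k x \<bullet> T_field \<sigma> x = (real (\<sigma> k) - 1) * Y x $ k"
proof -
  have dk: "((\<lambda>x. Y x $ k) has_derivative (\<lambda>v. A k y \<bullet> v)) (at y)" for y
    using A by (simp add: C1_bar_grad_def)
  have dil1: "dil \<sigma> 1 x = x" by (simp add: dil_def)
  have "((\<lambda>t. dil \<sigma> t x) has_derivative (\<lambda>h. h *\<^sub>R T_field \<sigma> x)) (at 1)"
    unfolding has_derivative_componentwise_within[of "\<lambda>t. dil \<sigma> t x"]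
    by (auto simp: Basis_vec_def inner_axis dil_def T_field_def intro!: derivative_eq_intros)
  from has_derivative_gradient_compose[where f = "\<lambda>y. Y y $ k", OF this dk]
  have "((\<lambda>t. Y (dil \<sigma> t x) $ k) has_derivative (\<lambda>h. A k x \<bullet> (h *\<^sub>R T_field \<sigma> x))) (at 1)"
    by (simp add: dil1)
  from has_derivative_mult[OF has_derivative_ident this]
  have "((\<lambda>t. t * Y (dil \<sigma> t x) $ k) has_derivative (\<lambda>h. h * (A k x \<bullet> T_field \<sigma> x + Y x $ k))) (at 1)"
    by (simp add: dil1 algebra_simps)
  then have "((\<lambda>t. t ^ \<sigma> k * Y x $ k) has_derivative (\<lambda>h. h * (A k x \<bullet> T_field \<sigma> x + Y x $ k))) (at 1)"
    by (rule has_derivative_transform_within_open[of _ _ _ _ "{0<..}"])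
       (auto simp: homogeneous_deg1_component[OF hom])
  moreover have "((\<lambda>t. t ^ \<sigma> k * Y x $ k) has_derivative (\<lambda>h. h * (real (\<sigma> k) * Y x $ k))) (at 1)"
    by (auto intro!: derivative_eq_intros)
  ultimately have "(\<lambda>h. h * (A k x \<bullet> T_field \<sigma> x + Y x $ k)) = (\<lambda>h. h * (real (\<sigma> k) * Y x $ k))"
    by (rule has_derivative_unique)
  from fun_cong[OF this, of 1] show ?thesis by (simp add: algebra_simps)
qed

text \<open>The \<open>k\<close>-th component does not depend on the \<open>k\<close>-th variable, because the derivative would be
  homogeneous of degree -1 and yet bounded near \<open>dil \<sigma> 0 x\<close>. Hence the divergence of \<open>Y\<close>
  vanishes.\<close>

lemma homogeneous_deg1_diagonal_zero:
  fixes Y :: "'n::finite vfield"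
  assumes hom: "homogeneous_deg1 \<sigma> Y" and A: "C1_bar_grad UNIV (\<lambda>x. Y x $ k) (A k)"
  shows "A k x $ k = 0"
proof -
  have dk: "((\<lambda>x. Y x $ k) has_derivative (\<lambda>v. A k y \<bullet> v)) (at y)" for y
    using A by (simp add: C1_bar_grad_def)
  have scale: "t * A k (dil \<sigma> t x) $ k = A k x $ k" if t: "0 < t" for t
  proof -
    \<comment> \<open>The identity \<open>homogeneous_deg1_component\<close> is differentiated along the line through \<open>x\<close> in
      direction \<open>k\<close>, once for each side.\<close>
    have "((\<lambda>s. x + s *\<^sub>R axis k 1) has_derivative (\<lambda>h. h *\<^sub>R axis k 1)) (at 0)"
      by (auto intro!: derivative_eq_intros)
    from has_derivative_gradient_compose[where f = "\<lambda>y. Y y $ k", OF this dk]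
    have "((\<lambda>s. Y (x + s *\<^sub>R axis k 1) $ k) has_derivative (\<lambda>h. h * A k x $ k)) (at 0)"
      by (simp add: inner_axis)
    from has_derivative_mult_right[OF this, of "t ^ \<sigma> k"]
    have 1: "((\<lambda>s. t * Y (dil \<sigma> t (x + s *\<^sub>R axis k 1)) $ k) has_derivative (\<lambda>h. t ^ \<sigma> k * (h * A k x $ k))) (at 0)"
      by (simp add: homogeneous_deg1_component[OF hom t])
    have "dil \<sigma> t (x + s *\<^sub>R axis k 1) = dil \<sigma> t x + (t ^ \<sigma> k * s) *\<^sub>R axis k 1" for s
      by (simp add: dil_def vec_eq_iff axis_def algebra_simps)
    then have d: "((\<lambda>s. dil \<sigma> t (x + s *\<^sub>R axis k 1)) has_derivative (\<lambda>h. (t ^ \<sigma> k * h) *\<^sub>R axis k 1)) (at 0)"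
      by (auto intro!: derivative_eq_intros)
    from has_derivative_mult_right[OF has_derivative_gradient_compose[where f = "\<lambda>y. Y y $ k", OF d dk], of t]
    have 2: "((\<lambda>s. t * Y (dil \<sigma> t (x + s *\<^sub>R axis k 1)) $ k) has_derivative (\<lambda>h. t * (t ^ \<sigma> k * h * A k (dil \<sigma> t x) $ k))) (at 0)"
      by (simp add: inner_axis)
    from fun_cong[OF has_derivative_unique[OF 1 2], of 1] t show ?thesis by (simp)
  qed
  \<comment> \<open>The left-hand side of \<open>scale\<close> tends to zero with \<open>t\<close>.\<close>
  have "continuous_on UNIV (A k)" using A by (simp add: C1_bar_grad_def)
  moreover have "continuous_on UNIV (\<lambda>t. dil \<sigma> t x)"
    unfolding dil_def by (intro continuous_on_vec_lambda continuous_intros)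
  ultimately have "continuous_on UNIV (\<lambda>t. A k (dil \<sigma> t x))"
    by (rule continuous_on_compose2) simp
  then have "continuous_on UNIV (\<lambda>t. t * A k (dil \<sigma> t x) $ k)"
    by (intro continuous_on_mult continuous_on_component continuous_on_id)
  then have "((\<lambda>t. t * A k (dil \<sigma> t x) $ k) \<longlongrightarrow> 0 * A k (dil \<sigma> 0 x) $ k) (at 0)"
    unfolding continuous_on_def by blast
  then have "((\<lambda>t. t * A k (dil \<sigma> t x) $ k) \<longlongrightarrow> 0 * A k (dil \<sigma> 0 x) $ k) (at_right 0)"
    by (rule tendsto_within_subset) simp
  then have lim: "((\<lambda>t. t * A k (dil \<sigma> t x) $ k) \<longlongrightarrow> 0) (at_right 0)"
    by simp
  have "((\<lambda>t. A k x $ k) \<longlongrightarrow> 0) (at_right (0::real))"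
    by (rule Lim_transform_eventually[OF lim]) (simp add: eventually_at_filter scale)
  then show ?thesis
    by (simp add: tendsto_const_iff)
qed

section \<open>Integrals over a domain and over its boundary\<close>

lemma set_integrable_continuous_closure:
  fixes f :: "'a::euclidean_space \<Rightarrow> real"
  assumes "open \<Omega>" "bounded \<Omega>" "continuous_on (closure \<Omega>) f"
  shows "set_integrable lborel \<Omega> f"
proof (rule set_integrable_subset)
  show "set_integrable lborel (closure \<Omega>) f"
    unfolding set_integrable_def using assms
    by (intro borel_integrable_compact) (auto simp: compact_closure)
qed (use assms closure_subset in auto)

text \<open>No measurability is required of \<open>S\<close>, \<open>f\<close> or \<open>g\<close>.\<close>

lemma set_integral_cong_pointwise:
  fixes f g :: "'a \<Rightarrow> 'b::{banach, second_countable_topology}"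
  assumes "\<And>x. x \<in> S \<Longrightarrow> f x = g x"
  shows "(LINT x:S|M. f x) = (LINT x:S|M. g x)"
  unfolding set_lebesgue_integral_def
  by (intro Bochner_Integration.integral_cong refl) (simp add: assms split: split_indicator)

text \<open>Here \<open>E\<close> stands for the boundary, \<open>M\<close> for its surface measure and \<open>\<nu>\<close> for its unit normal.\<close>

lemma flux_integrable_bound:
  fixes M :: "'a::euclidean_space measure" and \<nu> W :: "'a \<Rightarrow> 'a"
  assumes M: "sets M = sets borel" and E: "compact E" "emeasure M E < \<infinity>"
    and meas: "set_borel_measurable M E \<nu>"
    and unit: "AE x in M. x \<in> E \<longrightarrow> norm (\<nu> x) = 1"
    and W: "continuous_on E W" and B: "\<And>x. x \<in> E \<Longrightarrow> norm (W x) \<le> B"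
  shows "set_integrable M E (\<lambda>x. W x \<bullet> \<nu> x)"
    and "\<bar>LINT x:E|M. W x \<bullet> \<nu> x\<bar> \<le> B * measure M E"
proof -
  have Eb: "E \<in> sets M" using M E(1) by (simp add: compact_imp_closed)
  have "(\<lambda>x. indicator E x *\<^sub>R W x) \<in> borel_measurable M"
    using borel_measurable_continuous_on_indicator[OF _ W] Eb M
    by (simp cong: measurable_cong_sets)
  then have "(\<lambda>x. (indicator E x *\<^sub>R W x) \<bullet> (indicator E x *\<^sub>R \<nu> x)) \<in> borel_measurable M"
    using meas unfolding set_borel_measurable_def by (rule borel_measurable_inner)
  also have "(\<lambda>x. (indicator E x *\<^sub>R W x) \<bullet> (indicator E x *\<^sub>R \<nu> x)) = (\<lambda>x. indicator E x *\<^sub>R (W x \<bullet> \<nu> x))"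
    by (auto simp: indicator_def fun_eq_iff)
  finally have m: "(\<lambda>x. indicator E x *\<^sub>R (W x \<bullet> \<nu> x)) \<in> borel_measurable M" .
  have bd: "AE x in M. norm (indicator E x *\<^sub>R (W x \<bullet> \<nu> x)) \<le> indicator E x * B"
    using unit
  proof eventually_elim
    case (elim x)
    have "\<bar>W x \<bullet> \<nu> x\<bar> \<le> norm (W x) * norm (\<nu> x)" by (rule Cauchy_Schwarz_ineq2)
    then show ?case using elim B[of x] by (auto simp: indicator_def)
  qed
  have iB: "integrable M (\<lambda>x. indicator E x * B)"
    using E(2) Eb by simp
  show i: "set_integrable M E (\<lambda>x. W x \<bullet> \<nu> x)"
    unfolding set_integrable_def
    by (rule Bochner_Integration.integrable_bound[OF iB m]) (rule AE_mp[OF bd], rule AE_I2, auto simp: abs_mult split: split_indicator)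
  have "norm (LINT x:E|M. W x \<bullet> \<nu> x) \<le> (\<integral>x. indicator E x * B \<partial>M)"
    unfolding set_lebesgue_integral_def
    by (rule order_trans[OF integral_norm_bound integral_mono_AE])
       (use i bd iB in \<open>auto simp: set_integrable_def simp del: norm_scaleR intro!: integrable_norm\<close>)
  then show "\<bar>LINT x:E|M. W x \<bullet> \<nu> x\<bar> \<le> B * measure M E"
    using Eb by (simp add: mult.commute)
qed

text \<open>By the Stone-Weierstrass theorem, polynomial test functions suffice to show that a flux
  vanishes against all continuous test functions.\<close>

lemma flux_zero_if_zero_against_polynomials:
  fixes M :: "'a::euclidean_space measure" and \<nu> w :: "'a \<Rightarrow> 'a" and \<phi> :: "'a \<Rightarrow> real"
  assumes M: "sets M = sets borel" "compact E" "emeasure M E < \<infinity>" "set_borel_measurable M E \<nu>"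
    "AE x in M. x \<in> E \<longrightarrow> norm (\<nu> x) = 1"
    and w: "continuous_on E w" and \<phi>: "continuous_on E \<phi>"
    and zero: "\<And>p. real_polynomial_function p \<Longrightarrow> (LINT x:E|M. p x * (w x \<bullet> \<nu> x)) = 0"
  shows "(LINT x:E|M. \<phi> x * (w x \<bullet> \<nu> x)) = 0"
proof -
  obtain B where B: "B > 0" "\<And>x. x \<in> E \<Longrightarrow> norm (w x) \<le> B"
    using compact_imp_bounded[OF compact_continuous_image[OF w M(2)]]
    unfolding bounded_pos by auto
  have bd: "\<bar>LINT x:E|M. \<phi> x * (w x \<bullet> \<nu> x)\<bar> \<le> e * B * measure M E" if e: "e > 0" for e
  proof -
    obtain p where p: "real_polynomial_function p" "\<And>x. x \<in> E \<Longrightarrow> \<bar>\<phi> x - p x\<bar> < e"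
      using Stone_Weierstrass_real_polynomial_function[OF M(2) \<phi> e] by blast
    have cp: "continuous_on E p"
      using p(1) continuous_on_polymonial_function by (metis real_polynomial_function_eq)
    have int: "set_integrable M E (\<lambda>x. f x * (w x \<bullet> \<nu> x))" if f: "continuous_on E f" for f
    proof -
      have c: "continuous_on E (\<lambda>x. f x *\<^sub>R w x)" by (intro continuous_intros f w)
      obtain C where "\<And>x. x \<in> E \<Longrightarrow> norm (f x *\<^sub>R w x) \<le> C"
        using compact_imp_bounded[OF compact_continuous_image[OF c M(2)]]
        unfolding bounded_pos by auto
      from flux_integrable_bound(1)[OF M c this] show ?thesis by simp
    qed
    have c: "continuous_on E (\<lambda>x. (\<phi> x - p x) *\<^sub>R w x)" by (intro continuous_intros \<phi> w cp)
    have nb: "norm ((\<phi> x - p x) *\<^sub>R w x) \<le> e * B" if "x \<in> E" for x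
      using p(2)[OF that] B(2)[OF that] e by (auto intro!: mult_mono)
    have "\<bar>LINT x:E|M. (\<phi> x * (w x \<bullet> \<nu> x) - p x * (w x \<bullet> \<nu> x))\<bar> \<le> e * B * measure M E"
      using flux_integrable_bound(2)[OF M c nb] by (simp add: left_diff_distrib inner_diff_left)
    then show ?thesis
      using zero[OF p(1)] by (simp add: set_integral_diff(2)[OF int[OF \<phi>] int[OF cp]])
  qed
  show ?thesis
  proof (rule ccontr)
    assume ne: "(LINT x:E|M. \<phi> x * (w x \<bullet> \<nu> x)) \<noteq> 0" (is "?I \<noteq> 0")
    define D where "D = B * measure M E + 1"
    have D: "D > 0" "B * measure M E < D" using B by (auto simp: D_def intro: add_nonneg_pos)
    have "\<bar>?I\<bar> \<le> \<bar>?I\<bar> / D * B * measure M E" using bd[of "\<bar>?I\<bar> / D"] ne D by simp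
    also have "\<dots> = \<bar>?I\<bar> * (B * measure M E / D)" by simp
    also have "\<dots> < \<bar>?I\<bar> * 1" using D ne by (intro mult_strict_left_mono) auto
    finally show False by simp
  qed
qed

section \<open>Gradients of polynomial functions\<close>

lemma real_polynomial_function_gradient:
  fixes p :: "'a::euclidean_space \<Rightarrow> real"
  assumes "real_polynomial_function p"
  shows "\<exists>q. (\<forall>x. (p has_derivative (\<lambda>v. q x \<bullet> v)) (at x)) \<and> (\<forall>b. real_polynomial_function (\<lambda>x. q x \<bullet> b))"
  using assms
proof (induction p)
  case (linear f)
  have "(f has_derivative (\<lambda>v. (\<Sum>b\<in>Basis. f b *\<^sub>R b) \<bullet> v)) (at x)" for x
    using inner_sum_Basis_linear[OF bounded_linear.linear[OF linear]] bounded_linear_imp_has_derivative[OF linear]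
    by simp
  then show ?case by (intro exI[of _ "\<lambda>x. \<Sum>b\<in>Basis. f b *\<^sub>R b"]) (auto intro: real_polynomial_function.intros(2))
next
  case (const c)
  show ?case by (intro exI[of _ "\<lambda>x. 0"]) (auto intro: real_polynomial_function.intros(2))
next
  case (add f g)
  then obtain qf qg where
    "\<forall>x. (f has_derivative (\<lambda>v. qf x \<bullet> v)) (at x)" "\<forall>b. real_polynomial_function (\<lambda>x. qf x \<bullet> b)"
    "\<forall>x. (g has_derivative (\<lambda>v. qg x \<bullet> v)) (at x)" "\<forall>b. real_polynomial_function (\<lambda>x. qg x \<bullet> b)"
    by blast
  then show ?case
    by (intro exI[of _ "\<lambda>x. qf x + qg x"])
      (auto simp: inner_add_left intro!: derivative_eq_intros real_polynomial_function.intros(3))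
next
  case (mult f g)
  then obtain qf qg where
    "\<forall>x. (f has_derivative (\<lambda>v. qf x \<bullet> v)) (at x)" "\<forall>b. real_polynomial_function (\<lambda>x. qf x \<bullet> b)"
    "\<forall>x. (g has_derivative (\<lambda>v. qg x \<bullet> v)) (at x)" "\<forall>b. real_polynomial_function (\<lambda>x. qg x \<bullet> b)"
    by blast
  then show ?case using mult.hyps
    by (intro exI[of _ "\<lambda>x. f x *\<^sub>R qg x + g x *\<^sub>R qf x"])
      (auto simp: inner_add_left algebra_simps intro!: derivative_eq_intros real_polynomial_function.intros(3) real_polynomial_function.intros(4))
qed

lemma real_polynomial_function_C1_bar_grad:
  fixes p :: "'a::euclidean_space \<Rightarrow> real"
  assumes "real_polynomial_function p"
  shows "\<exists>q. C1_bar_grad UNIV p q \<and> (\<forall>b. real_polynomial_function (\<lambda>x. q x \<bullet> b))"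
proof -
  have c: "continuous_on UNIV f" if "real_polynomial_function f" for f :: "'a \<Rightarrow> real"
    using that continuous_on_polymonial_function by (metis real_polynomial_function_eq)
  obtain q where q: "\<forall>x. (p has_derivative (\<lambda>v. q x \<bullet> v)) (at x)" "\<forall>b. real_polynomial_function (\<lambda>x. q x \<bullet> b)"
    using real_polynomial_function_gradient[OF assms] by blast
  have "continuous_on UNIV q"
    using q(2) c by (subst continuous_on_componentwise) auto
  then show ?thesis using q c[OF assms] by (auto simp: C1_bar_grad_def)
qed

section \<open>The Divergence Theorem for a regular domain\<close>

lemma T_field_C1_bar_grad:
  "C1_bar_grad \<Omega> (\<lambda>x. T_field \<sigma> x $ j) (\<lambda>x. real (\<sigma> j) *\<^sub>R axis j 1)"
proof -
  have "(\<lambda>x::real^'a. T_field \<sigma> x $ j) = (\<lambda>x. (real (\<sigma> j) *\<^sub>R axis j 1) \<bullet> x)"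
    by (auto simp: T_field_def inner_axis' fun_eq_iff)
  then show ?thesis by (simp only: C1_bar_grad_inner_const)
qed

lemma divergence_theorem_product:
  fixes \<Omega> :: "(real^'n::finite) set"
  assumes "divergence_regular \<Omega> \<nu>"
    and f: "C1_bar_grad \<Omega> f g" and Y: "\<And>j. C1_bar_grad \<Omega> (\<lambda>x. Y x $ j) (A j)"
  shows "(LINT x:\<Omega>|lborel. g x \<bullet> Y x + f x * (\<Sum>j\<in>UNIV. A j x $ j))
       = (LINT x:frontier \<Omega>|surf. f x * (Y x \<bullet> \<nu> x))"
proof -
  have c: "C1_bar_grad \<Omega> (\<lambda>x. (f x *\<^sub>R Y x) $ j) (\<lambda>x. f x *\<^sub>R A j x + Y x $ j *\<^sub>R g x)" for j
    using C1_bar_grad_mult[OF f Y[of j]] by simp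
  have "(LINT x:\<Omega>|lborel. divg (\<lambda>x. f x *\<^sub>R Y x) x) = (LINT x:frontier \<Omega>|surf. (f x *\<^sub>R Y x) \<bullet> \<nu> x)"
    using assms(1) Ck_bar_1_vector(1)[OF c] unfolding divergence_regular_def by blast
  moreover have "(LINT x:\<Omega>|lborel. divg (\<lambda>x. f x *\<^sub>R Y x) x)
      = (LINT x:\<Omega>|lborel. g x \<bullet> Y x + f x * (\<Sum>j\<in>UNIV. A j x $ j))"
    by (rule set_integral_cong_pointwise)
       (simp add: Ck_bar_1_vector(2)[OF c] inner_vec_def sum.distrib sum_distrib_left mult.commute
           add.commute)
  ultimately show ?thesis by simp
qed

lemma boundary_data:
  fixes \<Omega> :: "(real^'n::finite) set"
  assumes "bounded \<Omega>" "divergence_regular \<Omega> \<nu>"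
  shows "sets (surf :: (real^'n) measure) = sets borel" "compact (frontier \<Omega>)"
    "emeasure surf (frontier \<Omega>) < \<infinity>" "set_borel_measurable surf (frontier \<Omega>) \<nu>"
    "AE x in surf. x \<in> frontier \<Omega> \<longrightarrow> norm (\<nu> x) = 1"
proof -
  show "sets (surf :: (real^'n) measure) = sets borel"
    unfolding surf_def hausdorff_def by (simp add: sets_measure_of sets.sigma_sets_eq[of borel, simplified])
  show "AE x in surf. x \<in> frontier \<Omega> \<longrightarrow> norm (\<nu> x) = 1"
    using assms(2) unfolding divergence_regular_def outward_unit_normal_def
    by (auto elim!: eventually_mono)
qed (use assms in \<open>auto simp: divergence_regular_def compact_frontier_bounded\<close>)

lemma flux_integrable:
  fixes \<Omega> :: "(real^'n::finite) set"
  assumes "bounded \<Omega>" "divergence_regular \<Omega> \<nu>" "continuous_on (closure \<Omega>) W"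
  shows "set_integrable surf (frontier \<Omega>) (\<lambda>x. W x \<bullet> \<nu> x)"
proof -
  have c: "continuous_on (frontier \<Omega>) W"
    using assms(3) by (rule continuous_on_subset) (simp add: frontier_def)
  obtain C where "\<And>x. x \<in> frontier \<Omega> \<Longrightarrow> norm (W x) \<le> C"
    using compact_imp_bounded[OF compact_continuous_image[OF c compact_frontier_bounded[OF assms(1)]]]
    unfolding bounded_pos by auto
  from flux_integrable_bound(1)[OF boundary_data[OF assms(1,2)] c this] show ?thesis .
qed

section \<open>The boundary gradient of a function that vanishes on the boundary\<close>

lemma hessian_symmetric:
  fixes g :: "real^'n::finite \<Rightarrow> real^'n"
  assumes "open \<Omega>" "C1_bar_grad \<Omega> f g" and h: "\<And>l. C1_bar_grad \<Omega> (\<lambda>x. g x $ l) (h l)"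
    and x: "x \<in> \<Omega>"
  shows "h j x $ k = h k x $ j"
proof -
  have cs: "continuous_on \<Omega> (h l)" for l
    using h[of l] closure_subset unfolding C1_bar_grad_def by (auto intro: continuous_on_subset)
  have d: "((\<lambda>y. g y \<bullet> axis l 1) has_derivative (\<lambda>v. h l y \<bullet> v)) (at y)" if "y \<in> \<Omega>" for y l
    using h[of l] that by (simp add: C1_bar_grad_def inner_axis)
  have "h j x \<bullet> axis k 1 = h k x \<bullet> axis j 1"
    by (rule second_derivative_symmetric[OF assms(1) x _ d cs d cs])
       (use assms(2) in \<open>auto simp: C1_bar_grad_def\<close>)
  then show ?thesis by (simp add: inner_axis)
qed

text \<open>The field \<open>g\<^sub>j e\<^sub>k - g\<^sub>k e\<^sub>j\<close>. Its inner products with a unit vector \<open>\<nu>\<close> vanish for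
  all \<open>j\<close> and \<open>k\<close> exactly when \<open>g\<close> is a multiple of \<open>\<nu>\<close>; it is divergence free when \<open>g\<close> is the
  gradient of a function with continuous second derivatives.\<close>

definition rot_field :: "'n::finite \<Rightarrow> 'n \<Rightarrow> (real^'n \<Rightarrow> real^'n) \<Rightarrow> real^'n \<Rightarrow> real^'n" where
  "rot_field j k g x = g x $ j *\<^sub>R axis k 1 - g x $ k *\<^sub>R axis j 1"

lemma rot_field_C1_bar_grad:
  fixes g :: "real^'n::finite \<Rightarrow> real^'n"
  assumes "open \<Omega>" "C1_bar_grad \<Omega> f g" and h: "\<And>l. C1_bar_grad \<Omega> (\<lambda>x. g x $ l) (h l)"
  shows "\<exists>A. (\<forall>l. C1_bar_grad \<Omega> (\<lambda>x. rot_field j k g x $ l) (A l)) \<and>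
    (\<forall>x\<in>\<Omega>. (\<Sum>l\<in>UNIV. A l x $ l) = 0)"
proof (intro exI conjI allI ballI)
  let ?A = "\<lambda>l x. (axis k 1 $ l) *\<^sub>R h j x + (- (axis j 1 $ l)) *\<^sub>R h k x"
  show "C1_bar_grad \<Omega> (\<lambda>x. rot_field j k g x $ l) (?A l)" for l
    using C1_bar_grad_add[OF C1_bar_grad_mult[OF C1_bar_grad_const h[of j]]
        C1_bar_grad_mult[OF C1_bar_grad_const h[of k]], of "axis k 1 $ l" "- (axis j 1 $ l)"]
    by (simp add: rot_field_def mult.commute)
  fix x assume x: "x \<in> \<Omega>"
  have e: "h j x $ k = h k x $ j"
    by (rule hessian_symmetric[OF assms(1,2) h x])
  show "(\<Sum>l\<in>UNIV. ?A l x $ l) = 0"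
    by (simp add: axis_def sum_subtractf if_distrib[of "\<lambda>c. c * _"] e cong: if_cong)
qed

text \<open>A weak form of the fact that the gradient of \<open>u\<close> is normal to the boundary where \<open>u\<close>
  vanishes. The boundary need not be smooth: for a polynomial \<open>p\<close> with gradient \<open>q\<close>, the
  fields \<open>p (g\<^sub>j e\<^sub>k - g\<^sub>k e\<^sub>j)\<close> and \<open>u (q\<^sub>k e\<^sub>j - q\<^sub>j e\<^sub>k)\<close> have the same divergence, and the
  second one vanishes on the boundary.\<close>

lemma tangential_gradient_zero:
  fixes \<Omega> :: "(real^'n::finite) set"
  assumes "open \<Omega>" "bounded \<Omega>" and dr: "divergence_regular \<Omega> \<nu>"
    and u: "C1_bar_grad \<Omega> u g" and h: "\<And>l. C1_bar_grad \<Omega> (\<lambda>x. g x $ l) (h l)"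
    and u0: "\<And>x. x \<in> frontier \<Omega> \<Longrightarrow> u x = 0"
    and \<phi>: "continuous_on (closure \<Omega>) \<phi>"
  shows "(LINT x:frontier \<Omega>|surf. \<phi> x * (rot_field j k g x \<bullet> \<nu> x)) = 0"
proof (rule flux_zero_if_zero_against_polynomials[OF boundary_data[OF assms(2) dr]])
  have fc: "frontier \<Omega> \<subseteq> closure \<Omega>" by (simp add: frontier_def)
  show "continuous_on (frontier \<Omega>) \<phi>" using \<phi> fc by (rule continuous_on_subset)
  have "continuous_on (closure \<Omega>) g" using u by (simp add: C1_bar_grad_def)
  then show "continuous_on (frontier \<Omega>) (rot_field j k g)"
    unfolding rot_field_def using fc by (auto intro!: continuous_intros intro: continuous_on_subset)
  fix p :: "real^'n \<Rightarrow> real" assume "real_polynomial_function p"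
  then obtain q where q: "C1_bar_grad UNIV p q" "\<And>b. real_polynomial_function (\<lambda>x. q x \<bullet> b)"
    using real_polynomial_function_C1_bar_grad by blast
  have "\<exists>r. C1_bar_grad UNIV (\<lambda>x. q x $ l) r" for l
    using real_polynomial_function_C1_bar_grad[OF q(2)[of "axis l 1"]] by (auto simp: inner_axis)
  then obtain r where r: "\<And>l. C1_bar_grad UNIV (\<lambda>x. q x $ l) (r l)" by metis
  have p': "C1_bar_grad \<Omega> p q" "\<And>l. C1_bar_grad \<Omega> (\<lambda>x. q x $ l) (r l)"
    using q(1) r by (auto intro: C1_bar_grad_subset)
  obtain A where A: "\<And>l. C1_bar_grad \<Omega> (\<lambda>x. rot_field j k g x $ l) (A l)"
    "\<And>x. x \<in> \<Omega> \<Longrightarrow> (\<Sum>l\<in>UNIV. A l x $ l) = 0"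
    using rot_field_C1_bar_grad[OF assms(1) u h] by blast
  obtain B where B: "\<And>l. C1_bar_grad \<Omega> (\<lambda>x. rot_field k j q x $ l) (B l)"
    "\<And>x. x \<in> \<Omega> \<Longrightarrow> (\<Sum>l\<in>UNIV. B l x $ l) = 0"
    using rot_field_C1_bar_grad[OF assms(1) p'] by blast
  have "(LINT x:frontier \<Omega>|surf. p x * (rot_field j k g x \<bullet> \<nu> x))
      = (LINT x:\<Omega>|lborel. q x \<bullet> rot_field j k g x + p x * (\<Sum>l\<in>UNIV. A l x $ l))"
    by (rule divergence_theorem_product[OF dr p'(1) A(1), symmetric])
  also have "\<dots> = (LINT x:\<Omega>|lborel. g x \<bullet> rot_field k j q x + u x * (\<Sum>l\<in>UNIV. B l x $ l))"
    by (rule set_integral_cong_pointwise)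
       (simp add: A B rot_field_def inner_diff_right inner_axis mult.commute)
  also have "\<dots> = (LINT x:frontier \<Omega>|surf. u x * (rot_field k j q x \<bullet> \<nu> x))"
    by (rule divergence_theorem_product[OF dr u B(1)])
  also have "\<dots> = (LINT x:frontier \<Omega>|surf. 0)"
    by (rule set_integral_cong_pointwise) (simp add: u0)
  finally show "(LINT x:frontier \<Omega>|surf. p x * (rot_field j k g x \<bullet> \<nu> x)) = 0"
    by (simp add: set_lebesgue_integral_def)
qed

text \<open>If \<open>g x\<close> is a multiple of \<open>\<nu> x\<close>, the two integrands coincide. In general their difference is
  a combination of the fluxes in \<open>tangential_gradient_zero\<close>, with continuous coefficients.\<close>

lemma normal_exchange:
  fixes \<Omega> :: "(real^'n::finite) set"
  assumes "open \<Omega>" "bounded \<Omega>" and dr: "divergence_regular \<Omega> \<nu>"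
    and u: "C1_bar_grad \<Omega> u g" and h: "\<And>l. C1_bar_grad \<Omega> (\<lambda>x. g x $ l) (h l)"
    and u0: "\<And>x. x \<in> frontier \<Omega> \<Longrightarrow> u x = 0"
    and Y: "continuous_on (closure \<Omega>) Y" and Z: "continuous_on (closure \<Omega>) Z"
  shows "(LINT x:frontier \<Omega>|surf. (g x \<bullet> Y x) * (Z x \<bullet> \<nu> x))
       = (LINT x:frontier \<Omega>|surf. (g x \<bullet> Z x) * (Y x \<bullet> \<nu> x))"
proof -
  let ?t = "\<lambda>j k x. (Y x $ j * Z x $ k) * (rot_field j k g x \<bullet> \<nu> x)"
  have cg: "continuous_on (closure \<Omega>) g" using u by (simp add: C1_bar_grad_def)
  have crot: "continuous_on (closure \<Omega>) (rot_field j k g)" for j k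
    unfolding rot_field_def using cg by (auto intro!: continuous_intros)
  have yz: "continuous_on (closure \<Omega>) (\<lambda>x. Y x $ j * Z x $ k)" for j k
    using Y Z by (auto intro!: continuous_intros)
  have int: "set_integrable surf (frontier \<Omega>) (?t j k)" for j k
    using flux_integrable[OF assms(2) dr continuous_on_scaleR[OF yz crot], of j k j k] by simp
  have int1: "set_integrable surf (frontier \<Omega>) (\<lambda>x. (g x \<bullet> Y x) * (Z x \<bullet> \<nu> x))"
    using flux_integrable[OF assms(2) dr, of "\<lambda>x. (g x \<bullet> Y x) *\<^sub>R Z x"]
    by (simp add: continuous_on_scaleR continuous_on_inner cg Y Z)
  have int2: "set_integrable surf (frontier \<Omega>) (\<lambda>x. (g x \<bullet> Z x) * (Y x \<bullet> \<nu> x))"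
    using flux_integrable[OF assms(2) dr, of "\<lambda>x. (g x \<bullet> Z x) *\<^sub>R Y x"]
    by (simp add: continuous_on_scaleR continuous_on_inner cg Y Z)
  have alg: "(g x \<bullet> Y x) * (Z x \<bullet> \<nu> x) - (g x \<bullet> Z x) * (Y x \<bullet> \<nu> x) = (\<Sum>j\<in>UNIV. \<Sum>k\<in>UNIV. ?t j k x)" for x
  proof -
    have "?t j k x = (g x $ j * Y x $ j) * (Z x $ k * \<nu> x $ k) - (g x $ k * Z x $ k) * (Y x $ j * \<nu> x $ j)" for j k
      by (simp add: rot_field_def inner_diff_left inner_axis' algebra_simps)
    then have "(\<Sum>j\<in>UNIV. \<Sum>k\<in>UNIV. ?t j k x)
      = (\<Sum>j\<in>UNIV. \<Sum>k\<in>UNIV. (g x $ j * Y x $ j) * (Z x $ k * \<nu> x $ k))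
       - (\<Sum>j\<in>UNIV. \<Sum>k\<in>UNIV. (g x $ k * Z x $ k) * (Y x $ j * \<nu> x $ j))"
      by (simp only: sum_subtractf)
    moreover have "(\<Sum>j\<in>UNIV. \<Sum>k\<in>UNIV. (g x $ k * Z x $ k) * (Y x $ j * \<nu> x $ j)) = (g x \<bullet> Z x) * (Y x \<bullet> \<nu> x)"
      by (subst sum.swap) (simp add: inner_vec_def sum_product)
    ultimately show ?thesis by (simp add: inner_vec_def sum_product)
  qed
  have "(LINT x:frontier \<Omega>|surf. (g x \<bullet> Y x) * (Z x \<bullet> \<nu> x)) - (LINT x:frontier \<Omega>|surf. (g x \<bullet> Z x) * (Y x \<bullet> \<nu> x))
     = (LINT x:frontier \<Omega>|surf. (\<Sum>j\<in>UNIV. \<Sum>k\<in>UNIV. ?t j k x))"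
    by (subst set_integral_diff(2)[OF int1 int2, symmetric]) (simp only: alg)
  also have "\<dots> = (\<Sum>j\<in>UNIV. \<Sum>k\<in>UNIV. LINT x:frontier \<Omega>|surf. ?t j k x)"
    using int unfolding set_lebesgue_integral_def set_integrable_def scaleR_sum_right
    by (simp only: Bochner_Integration.integral_sum Bochner_Integration.integrable_sum)
  also have "\<dots> = 0"
    using tangential_gradient_zero[OF assms(1,2) dr u h u0 yz] by simp
  finally show ?thesis by simp
qed

section \<open>The identity in terms of gradients\<close>

text \<open>The functions \<open>\<Phi>\<close>, \<open>fx\<close>, \<open>fz\<close>, \<open>p\<close> stand for the integrand and its partial derivatives
  along the solution \<open>u\<close>, and \<open>g\<close>, \<open>h\<close> for the gradient and the Hessian of \<open>u\<close>. The assumption on \<open>\<Phi>\<close> is the chain rule, and \<open>eq\<close> is the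
  Euler-Lagrange equation. Because the \<open>X i\<close> are divergence free, \<open>eq\<close> says that the field \<open>Y\<close>
  has divergence \<open>fz\<close>.\<close>

lemma pohozaev_core:
  fixes X :: "'m::finite \<Rightarrow> 'n::finite vfield" and \<Omega> :: "(real^'n) set"
    and p :: "real^'n \<Rightarrow> real^'m"
  assumes \<Omega>: "open \<Omega>" "bounded \<Omega>" and dr: "divergence_regular \<Omega> \<nu>"
    and A: "\<And>i k. C1_bar_grad UNIV (\<lambda>x. X i x $ k) (A i k)"
    and hom: "\<And>i. homogeneous_deg1 \<sigma> (X i)"
    and u: "C1_bar_grad \<Omega> u g" and h: "\<And>l. C1_bar_grad \<Omega> (\<lambda>x. g x $ l) (h l)"
    and Xu: "\<And>i. C1_bar_grad \<Omega> (\<lambda>x. X i x \<bullet> g x) (dXu i)"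
    and \<Phi>: "C1_bar_grad \<Omega> \<Phi> (\<lambda>x. fx x + fz x *\<^sub>R g x + (\<Sum>i\<in>UNIV. p x $ i *\<^sub>R dXu i x))"
    and fx: "continuous_on (closure \<Omega>) fx" and fz: "continuous_on (closure \<Omega>) fz"
    and p: "\<And>i. C1_bar_grad \<Omega> (\<lambda>x. p x $ i) (P i)"
    and eq: "\<And>x. x \<in> \<Omega> \<Longrightarrow> fz x = (\<Sum>i\<in>UNIV. P i x \<bullet> X i x)"
  defines "q \<equiv> \<Sum>j\<in>UNIV. real (\<sigma> j)"
    and "Y \<equiv> \<lambda>x. \<Sum>i\<in>UNIV. p x $ i *\<^sub>R X i x"
  shows "(LINT x:\<Omega>|lborel. q * \<Phi> x - g x \<bullet> Y x) + (LINT x:\<Omega>|lborel. T_field \<sigma> x \<bullet> fx x)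
      = (LINT x:frontier \<Omega>|surf. \<Phi> x * (T_field \<sigma> x \<bullet> \<nu> x))
       - (LINT x:frontier \<Omega>|surf. (g x \<bullet> T_field \<sigma> x) * (Y x \<bullet> \<nu> x))" (is ?free)
    and "(\<And>x. x \<in> frontier \<Omega> \<Longrightarrow> u x = 0) \<Longrightarrow>
      (LINT x:\<Omega>|lborel. q * \<Phi> x - (a + 1) * (g x \<bullet> Y x)) + (LINT x:\<Omega>|lborel. T_field \<sigma> x \<bullet> fx x)
       - a * (LINT x:\<Omega>|lborel. u x * fz x)
      = (LINT x:frontier \<Omega>|surf. (\<Phi> x - g x \<bullet> Y x) * (T_field \<sigma> x \<bullet> \<nu> x))"
proof -
  let ?T = "T_field \<sigma> :: real^'n \<Rightarrow> real^'n"
  have A\<Omega>: "C1_bar_grad \<Omega> (\<lambda>x. X i x $ k) (A i k)" for i k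
    using A by (auto intro: C1_bar_grad_subset)
  have AT: "A i k x \<bullet> ?T x = (real (\<sigma> k) - 1) * X i x $ k" for i k x
    using homogeneous_deg1_T_derivative[OF hom A] .
  have Ad: "A i k x $ k = 0" for i k x
    using homogeneous_deg1_diagonal_zero[OF hom A] .
  have cont: "continuous_on (closure \<Omega>) g" "continuous_on (closure \<Omega>) u" "continuous_on (closure \<Omega>) \<Phi>"
    using u \<Phi> by (auto simp: C1_bar_grad_def)
  have cont_T: "continuous_on (closure \<Omega>) ?T"
    unfolding T_field_def by (intro continuous_on_vec_lambda continuous_intros)
  have "continuous_on (closure \<Omega>) (\<lambda>x. \<chi> k. X i x $ k)" for i
    using A\<Omega> by (intro continuous_on_vec_lambda) (auto simp: C1_bar_grad_def)
  then have cont_X: "continuous_on (closure \<Omega>) (X i)" for i by simp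
  have cont_p: "continuous_on (closure \<Omega>) (\<lambda>x. p x $ i)" for i using p by (auto simp: C1_bar_grad_def)
  have cont_Y: "continuous_on (closure \<Omega>) Y"
    unfolding Y_def by (intro continuous_intros cont_X cont_p)
  note conts = cont cont_T cont_Y fx fz

  define YG where "YG k x = (\<Sum>i\<in>UNIV. p x $ i *\<^sub>R A i k x + X i x $ k *\<^sub>R P i x)" for k x
  have Y: "C1_bar_grad \<Omega> (\<lambda>x. Y x $ k) (YG k)" for k
  proof -
    have "C1_bar_grad \<Omega> (\<lambda>x. \<Sum>i\<in>UNIV. p x $ i * X i x $ k) (YG k)"
      unfolding YG_def by (intro C1_bar_grad_sum finite C1_bar_grad_mult p A\<Omega>)
    then show ?thesis by (simp add: Y_def)
  qed
  have divY: "(\<Sum>k\<in>UNIV. YG k x $ k) = fz x" if "x \<in> \<Omega>" for x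
  proof -
    have "(\<Sum>k\<in>UNIV. YG k x $ k) = (\<Sum>k\<in>UNIV. \<Sum>i\<in>UNIV. P i x $ k * X i x $ k)"
      by (simp add: YG_def Ad mult.commute)
    also have "\<dots> = (\<Sum>i\<in>UNIV. P i x \<bullet> X i x)"
      by (subst sum.swap) (simp add: inner_vec_def)
    finally show ?thesis using eq[OF that] by simp
  qed

  define TG where "TG x = (\<Sum>k\<in>UNIV. g x $ k *\<^sub>R (real (\<sigma> k) *\<^sub>R axis k 1) + ?T x $ k *\<^sub>R h k x)" for x
  have Tu: "C1_bar_grad \<Omega> (\<lambda>x. g x \<bullet> ?T x) TG"
    unfolding TG_def inner_vec_def inner_real_def
    by (intro C1_bar_grad_sum finite C1_bar_grad_mult h T_field_C1_bar_grad)
  note hsym = hessian_symmetric[OF \<Omega>(1) u h]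
  have dXu: "dXu i x = (\<Sum>k\<in>UNIV. X i x $ k *\<^sub>R h k x + g x $ k *\<^sub>R A i k x)" if x: "x \<in> \<Omega>" for i x
  proof -
    have "C1_bar_grad \<Omega> (\<lambda>x. X i x \<bullet> g x) (\<lambda>x. \<Sum>k\<in>UNIV. X i x $ k *\<^sub>R h k x + g x $ k *\<^sub>R A i k x)"
      unfolding inner_vec_def inner_real_def
      by (intro C1_bar_grad_sum finite C1_bar_grad_mult h A\<Omega>)
    then have eq_fun: "(\<lambda>v. dXu i x \<bullet> v) = (\<lambda>v. (\<Sum>k\<in>UNIV. X i x $ k *\<^sub>R h k x + g x $ k *\<^sub>R A i k x) \<bullet> v)"
      using Xu[of i] x has_derivative_unique unfolding C1_bar_grad_def by blast
    show ?thesis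
      by (rule iffD1[OF vector_eq_rdot], rule allI, rule fun_cong[OF eq_fun])
  qed
  \<comment> \<open>This is \<open>X\<^sub>i T u - T X\<^sub>i u = X\<^sub>i u\<close>. The terms with second derivatives of \<open>u\<close> cancel by symmetry of
    the Hessian, and the remaining ones are evaluated by Euler's relation.\<close>
  have commutator: "TG x \<bullet> X i x - dXu i x \<bullet> ?T x = g x \<bullet> X i x" if x: "x \<in> \<Omega>" for i x
  proof -
    have "(\<Sum>k\<in>UNIV. ?T x $ k * (h k x \<bullet> X i x)) = (\<Sum>k\<in>UNIV. \<Sum>l\<in>UNIV. ?T x $ k * (h k x $ l * X i x $ l))"
      by (simp add: inner_vec_def sum_distrib_left)
    also have "\<dots> = (\<Sum>k\<in>UNIV. \<Sum>l\<in>UNIV. X i x $ l * (h l x $ k * ?T x $ k))"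
      by (intro sum.cong refl) (subst hsym[OF x], simp)
    also have "\<dots> = (\<Sum>l\<in>UNIV. X i x $ l * (h l x \<bullet> ?T x))"
      by (subst sum.swap) (simp add: inner_vec_def sum_distrib_left)
    finally have s: "(\<Sum>k\<in>UNIV. ?T x $ k * (h k x \<bullet> X i x)) = (\<Sum>k\<in>UNIV. X i x $ k * (h k x \<bullet> ?T x))" .
    have "TG x \<bullet> X i x = (\<Sum>k\<in>UNIV. g x $ k * real (\<sigma> k) * X i x $ k) + (\<Sum>k\<in>UNIV. ?T x $ k * (h k x \<bullet> X i x))"
      by (simp add: TG_def inner_sum_left inner_add_left inner_axis' sum.distrib mult_ac)
    moreover have "dXu i x \<bullet> ?T x = (\<Sum>k\<in>UNIV. X i x $ k * (h k x \<bullet> ?T x))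
        + (\<Sum>k\<in>UNIV. g x $ k * ((real (\<sigma> k) - 1) * X i x $ k))"
      by (simp add: dXu[OF x] inner_sum_left inner_add_left sum.distrib AT)
    ultimately show ?thesis using s
      by (simp add: inner_vec_def sum_subtractf[symmetric] algebra_simps)
  qed
  have pointwise: "((fx x + fz x *\<^sub>R g x + (\<Sum>i\<in>UNIV. p x $ i *\<^sub>R dXu i x)) \<bullet> ?T x + \<Phi> x * q)
      - (TG x \<bullet> Y x + (g x \<bullet> ?T x) * fz x) = (q * \<Phi> x - g x \<bullet> Y x) + ?T x \<bullet> fx x"
    if x: "x \<in> \<Omega>" for x
  proof -
    have "(\<Sum>i\<in>UNIV. p x $ i *\<^sub>R dXu i x) \<bullet> ?T x - TG x \<bullet> Y x
        = - (\<Sum>i\<in>UNIV. p x $ i * (TG x \<bullet> X i x - dXu i x \<bullet> ?T x))"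
      by (simp add: Y_def inner_sum_left inner_sum_right sum_subtractf right_diff_distrib)
    also have "\<dots> = - (g x \<bullet> Y x)"
      by (simp add: commutator[OF x] Y_def inner_sum_right)
    finally show ?thesis by (simp add: inner_add_left inner_commute[of "?T x"] algebra_simps)
  qed

  have divT: "(\<Sum>j\<in>UNIV. (real (\<sigma> j) *\<^sub>R axis j 1) $ j) = q" by (simp add: q_def axis_def)
  have I1: "(LINT x:\<Omega>|lborel. (fx x + fz x *\<^sub>R g x + (\<Sum>i\<in>UNIV. p x $ i *\<^sub>R dXu i x)) \<bullet> ?T x + \<Phi> x * q)
      = (LINT x:frontier \<Omega>|surf. \<Phi> x * (?T x \<bullet> \<nu> x))"
    using divergence_theorem_product[OF dr \<Phi> T_field_C1_bar_grad[where \<sigma> = \<sigma>]] by (simp only: divT)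
  have fold_div: "(LINT x:\<Omega>|lborel. a x + b x * (\<Sum>k\<in>UNIV. YG k x $ k)) = (LINT x:\<Omega>|lborel. a x + b x * fz x)" for a b
    by (rule set_integral_cong_pointwise) (simp add: divY)
  have I2: "(LINT x:\<Omega>|lborel. TG x \<bullet> Y x + (g x \<bullet> ?T x) * fz x)
      = (LINT x:frontier \<Omega>|surf. (g x \<bullet> ?T x) * (Y x \<bullet> \<nu> x))"
    using divergence_theorem_product[OF dr Tu Y] by (simp only: fold_div)
  \<comment> \<open>Under the boundary condition on \<open>u\<close>, this identity allows any multiple \<open>a\<close> to be added.\<close>
  have I3: "(LINT x:\<Omega>|lborel. g x \<bullet> Y x + u x * fz x) = (LINT x:frontier \<Omega>|surf. u x * (Y x \<bullet> \<nu> x))"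
    using divergence_theorem_product[OF dr u Y] by (simp only: fold_div)
  note int\<Omega> = set_integrable_continuous_closure[OF \<Omega>]
  have c1: "continuous_on (closure \<Omega>) (\<lambda>x. (fx x + fz x *\<^sub>R g x + (\<Sum>i\<in>UNIV. p x $ i *\<^sub>R dXu i x)) \<bullet> ?T x + \<Phi> x * q)"
    using \<Phi> by (auto simp: C1_bar_grad_def intro!: continuous_intros conts)
  have c2: "continuous_on (closure \<Omega>) (\<lambda>x. TG x \<bullet> Y x + (g x \<bullet> ?T x) * fz x)"
    using Tu by (auto simp: C1_bar_grad_def intro!: continuous_intros conts)
  have c3: "continuous_on (closure \<Omega>) (\<lambda>x. q * \<Phi> x - c * (g x \<bullet> Y x))" for c
    by (intro continuous_intros conts)
  have c4: "continuous_on (closure \<Omega>) (\<lambda>x. ?T x \<bullet> fx x)"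
    by (intro continuous_intros conts)
  have c5: "continuous_on (closure \<Omega>) (\<lambda>x. a * (g x \<bullet> Y x + u x * fz x))"
    by (intro continuous_intros conts)
  have c6: "continuous_on (closure \<Omega>) (\<lambda>x. a * (u x * fz x))"
    by (intro continuous_intros conts)

  have "(LINT x:\<Omega>|lborel. q * \<Phi> x - g x \<bullet> Y x) + (LINT x:\<Omega>|lborel. ?T x \<bullet> fx x)
     = (LINT x:\<Omega>|lborel. (q * \<Phi> x - g x \<bullet> Y x) + ?T x \<bullet> fx x)"
    using set_integral_add(2)[OF int\<Omega>[OF c3[of 1]] int\<Omega>[OF c4]] by simp
  also have "\<dots> = (LINT x:\<Omega>|lborel. ((fx x + fz x *\<^sub>R g x + (\<Sum>i\<in>UNIV. p x $ i *\<^sub>R dXu i x)) \<bullet> ?T x + \<Phi> x * q)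
      - (TG x \<bullet> Y x + (g x \<bullet> ?T x) * fz x))"
    by (rule set_integral_cong_pointwise) (simp only: pointwise)
  also have "\<dots> = (LINT x:frontier \<Omega>|surf. \<Phi> x * (?T x \<bullet> \<nu> x))
       - (LINT x:frontier \<Omega>|surf. (g x \<bullet> ?T x) * (Y x \<bullet> \<nu> x))"
    unfolding I1[symmetric] I2[symmetric] by (rule set_integral_diff(2)[OF int\<Omega>[OF c1] int\<Omega>[OF c2]])
  finally show free: ?free .

  assume u0: "\<And>x. x \<in> frontier \<Omega> \<Longrightarrow> u x = 0"
  have "(LINT x:frontier \<Omega>|surf. u x * (Y x \<bullet> \<nu> x)) = (LINT x:frontier \<Omega>|surf. 0)"
    by (rule set_integral_cong_pointwise) (simp add: u0)
  with I3 have I3': "(LINT x:\<Omega>|lborel. a * (g x \<bullet> Y x + u x * fz x)) = 0"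
    by (simp add: set_lebesgue_integral_def)
  have "(LINT x:\<Omega>|lborel. q * \<Phi> x - (a + 1) * (g x \<bullet> Y x)) - a * (LINT x:\<Omega>|lborel. u x * fz x)
     = (LINT x:\<Omega>|lborel. (q * \<Phi> x - (a + 1) * (g x \<bullet> Y x)) - a * (u x * fz x))"
    using set_integral_diff(2)[OF int\<Omega>[OF c3[of "a + 1"]] int\<Omega>[OF c6]] by simp
  also have "\<dots> = (LINT x:\<Omega>|lborel. (q * \<Phi> x - 1 * (g x \<bullet> Y x)) - a * (g x \<bullet> Y x + u x * fz x))"
    by (simp add: algebra_simps)
  also have "\<dots> = (LINT x:\<Omega>|lborel. q * \<Phi> x - g x \<bullet> Y x)"
    using set_integral_diff(2)[OF int\<Omega>[OF c3[of 1]] int\<Omega>[OF c5]] I3' by simp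
  finally have vol: "(LINT x:\<Omega>|lborel. q * \<Phi> x - (a + 1) * (g x \<bullet> Y x)) - a * (LINT x:\<Omega>|lborel. u x * fz x)
    = (LINT x:\<Omega>|lborel. q * \<Phi> x - g x \<bullet> Y x)" .
  have b1: "set_integrable surf (frontier \<Omega>) (\<lambda>x. \<Phi> x * (?T x \<bullet> \<nu> x))"
    using flux_integrable[OF \<Omega>(2) dr, of "\<lambda>x. \<Phi> x *\<^sub>R ?T x"] by (simp add: continuous_intros conts)
  have b2: "set_integrable surf (frontier \<Omega>) (\<lambda>x. (g x \<bullet> Y x) * (?T x \<bullet> \<nu> x))"
    using flux_integrable[OF \<Omega>(2) dr, of "\<lambda>x. (g x \<bullet> Y x) *\<^sub>R ?T x"] by (simp add: continuous_intros conts)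
  have "(LINT x:frontier \<Omega>|surf. (\<Phi> x - g x \<bullet> Y x) * (?T x \<bullet> \<nu> x))
     = (LINT x:frontier \<Omega>|surf. \<Phi> x * (?T x \<bullet> \<nu> x)) - (LINT x:frontier \<Omega>|surf. (g x \<bullet> Y x) * (?T x \<bullet> \<nu> x))"
    using set_integral_diff(2)[OF b1 b2] by (simp add: left_diff_distrib)
  with free vol normal_exchange[OF \<Omega> dr u h u0 cont_T cont_Y]
  show "(LINT x:\<Omega>|lborel. q * \<Phi> x - (a + 1) * (g x \<bullet> Y x)) + (LINT x:\<Omega>|lborel. T_field \<sigma> x \<bullet> fx x)
       - a * (LINT x:\<Omega>|lborel. u x * fz x)
      = (LINT x:frontier \<Omega>|surf. (\<Phi> x - g x \<bullet> Y x) * (T_field \<sigma> x \<bullet> \<nu> x))" by linarith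
qed

section \<open>Regularity of the integrand along a solution\<close>

lemma vf_app_eq_inner:
  "C1_bar_grad \<Omega> f g \<Longrightarrow> x \<in> \<Omega> \<Longrightarrow> vf_app Y f x = g x \<bullet> Y x"
  unfolding vf_app_def C1_bar_grad_def using frechet_derivative_at by metis

lemma Ck_bar_2_imp_C1_bar_grad:
  fixes u :: "real^'n::finite \<Rightarrow> real"
  assumes "Ck_bar 2 \<Omega> u"
  shows "\<exists>g h. C1_bar_grad \<Omega> u g \<and> (\<forall>l. C1_bar_grad \<Omega> (\<lambda>x. g x $ l) (h l))"
proof -
  define D where "D v = bar_ext \<Omega> (\<lambda>x. frechet_derivative u (at x) v)" for v
  define g where "g x = (\<Sum>b\<in>Basis. D b x *\<^sub>R b)" for x
  have D: "Ck_bar 1 \<Omega> (D v)" for v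
    using assms by (simp add: numeral_2_eq_2 D_def)
  then have "Ck_bar 1 \<Omega> u"
    using assms by (simp add: numeral_2_eq_2 D_def)
  then have g: "C1_bar_grad \<Omega> u g"
    using Ck_bar_1_imp_C1_bar_grad unfolding g_def D_def by blast
  have "g x $ l = D (axis l 1) x" for x l
  proof -
    have "g x $ l = g x \<bullet> axis l 1" by (simp add: inner_axis)
    also have "\<dots> = D (axis l 1) x"
      unfolding g_def by (rule inner_sum_left_Basis) simp
    finally show ?thesis .
  qed
  then have "\<exists>h. C1_bar_grad \<Omega> (\<lambda>x. g x $ l) h" for l
    using Ck_bar_1_imp_C1_bar_grad[OF D[of "axis l 1"]] by auto
  with g show ?thesis by metis
qed

lemma linear_vec_inner:
  fixes L :: "real^'n::finite \<Rightarrow> real"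
  assumes "linear L"
  shows "L a = (\<chi> j. L (axis j 1)) \<bullet> a"
proof -
  have "L a = L (\<Sum>j\<in>UNIV. (a $ j) *\<^sub>R axis j 1)"
    by (simp add: basis_expansion flip: scalar_mult_eq_scaleR)
  also have "\<dots> = (\<Sum>j\<in>UNIV. a $ j * L (axis j 1))"
    by (simp add: linear_sum[OF assms] linear_scale[OF assms])
  finally show ?thesis by (simp add: inner_vec_def mult.commute)
qed

lemma integrand_C1_bar_grad:
  fixes F :: "(real^'n::finite) \<times> real \<times> (real^'m::finite) \<Rightarrow> real"
  assumes "P1 \<Omega> F"
  shows "C1_bar_grad (\<Omega> \<times> UNIV \<times> UNIV) F (\<lambda>w. (\<chi> j. D_x F j w, D_z F w, D_p F w))"
proof -
  obtain W where W: "closure (\<Omega> \<times> UNIV \<times> UNIV) \<subseteq> W" "Ck_on 1 W F"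
    using assms unfolding P1_def by blast
  then have d: "\<And>w. w \<in> W \<Longrightarrow> F differentiable (at w)"
    and c: "\<And>v. continuous_on W (\<lambda>w. frechet_derivative F (at w) v)"
    by (auto simp: One_nat_def)
  have fd: "(F has_derivative frechet_derivative F (at w)) (at w)" if "w \<in> W" for w
    using d[OF that] by (simp add: frechet_derivative_works)
  have rep: "frechet_derivative F (at w) v = (\<chi> j. D_x F j w, D_z F w, D_p F w) \<bullet> v" if "w \<in> W" for w v
  proof -
    let ?L = "frechet_derivative F (at w)"
    have L: "linear ?L" using fd[OF that] by (rule has_derivative_linear)
    obtain a b c where v: "v = (a, b, c)" by (cases v) auto
    have "v = (a, 0, 0) + b *\<^sub>R (0, 1, 0) + (0, 0, c)" by (simp add: v)
    then have "?L v = ?L (a, 0, 0) + b * ?L (0, 1, 0) + ?L (0, 0, c)"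
      by (simp only: linear_add[OF L] linear_scale[OF L] real_scaleR_def)
    moreover have "linear (\<lambda>a. ?L (a, 0, 0))"
      using linear_compose[OF _ L, of "\<lambda>a. (a, 0, 0)"] by (simp add: o_def linear_iff)
    then have "?L (a, 0, 0) = (\<chi> j. D_x F j w) \<bullet> a"
      unfolding D_x_def by (rule linear_vec_inner)
    moreover have "linear (\<lambda>c. ?L (0, 0, c))"
      using linear_compose[OF _ L, of "\<lambda>c. (0, 0, c)"] by (simp add: o_def linear_iff)
    then have "?L (0, 0, c) = D_p F w \<bullet> c"
      unfolding D_p_def by (rule linear_vec_inner)
    ultimately show ?thesis
      by (simp add: v D_z_def)
  qed
  have "continuous_on W F" 
    by (rule has_derivative_continuous_on) (rule has_derivative_at_withinI[OF fd])
  moreover have "continuous_on W (\<lambda>w. (\<chi> j. D_x F j w, D_z F w, D_p F w))"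
    unfolding D_x_def D_z_def D_p_def by (intro continuous_intros continuous_on_vec_lambda c)
  moreover have "(F has_derivative (\<lambda>v. (\<chi> j. D_x F j w, D_z F w, D_p F w) \<bullet> v)) (at w)"
    if "w \<in> \<Omega> \<times> UNIV \<times> UNIV" for w
  proof -
    have "w \<in> W" by (rule subsetD[OF W(1) subsetD[OF closure_subset that]])
    then show ?thesis using fd[of w] by (simp add: rep[symmetric])
  qed
  ultimately show ?thesis
    using W(1) by (auto simp: C1_bar_grad_def intro: continuous_on_subset)
qed

text \<open>The chain rule along \<open>x \<mapsto> (x, u x, G x)\<close>. The gradient \<open>k\<close> is a triple, matching the three
  groups of variables of \<open>K\<close>.\<close>

lemma C1_bar_grad_compose_jet:
  fixes K :: "(real^'n::finite) \<times> real \<times> (real^'m::finite) \<Rightarrow> real"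
  assumes K: "C1_bar_grad (\<Omega> \<times> UNIV \<times> UNIV) K k"
    and u: "C1_bar_grad \<Omega> u g" and G: "\<And>i. C1_bar_grad \<Omega> (\<lambda>x. G x $ i) (dG i)"
  shows "C1_bar_grad \<Omega> (\<lambda>x. K (x, u x, G x))
    (\<lambda>x. fst (k (x, u x, G x)) + fst (snd (k (x, u x, G x))) *\<^sub>R g x
      + (\<Sum>i\<in>UNIV. snd (snd (k (x, u x, G x))) $ i *\<^sub>R dG i x))"
proof -
  have cu: "continuous_on (closure \<Omega>) u" "continuous_on (closure \<Omega>) g" using u by (auto simp: C1_bar_grad_def)
  have cdG: "continuous_on (closure \<Omega>) (dG i)" for i using G by (simp add: C1_bar_grad_def)
  have "continuous_on (closure \<Omega>) (\<lambda>x. \<chi> i. G x $ i)"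
    using G by (intro continuous_on_vec_lambda) (simp add: C1_bar_grad_def)
  then have cJ: "continuous_on (closure \<Omega>) (\<lambda>x. (x, u x, G x))"
    by (intro continuous_intros cu) simp
  have JS: "(\<lambda>x. (x, u x, G x)) ` closure \<Omega> \<subseteq> closure (\<Omega> \<times> UNIV \<times> UNIV)"
    by (auto simp: closure_Times)
  have cK: "continuous_on (closure \<Omega>) (\<lambda>x. K (x, u x, G x))"
    and ck: "continuous_on (closure \<Omega>) (\<lambda>x. k (x, u x, G x))"
    using K cJ JS unfolding C1_bar_grad_def by (auto intro: continuous_on_compose2)
  have "((\<lambda>x. K (x, u x, G x)) has_derivative
    (\<lambda>v. (fst (k (x, u x, G x)) + fst (snd (k (x, u x, G x))) *\<^sub>R g x
      + (\<Sum>i\<in>UNIV. snd (snd (k (x, u x, G x))) $ i *\<^sub>R dG i x)) \<bullet> v)) (at x)" if x: "x \<in> \<Omega>" for x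
  proof -
    have dG: "(G has_derivative (\<lambda>v. \<chi> i. dG i x \<bullet> v)) (at x)"
      using G x by (intro has_derivative_vec_lambda_grad) (simp add: C1_bar_grad_def)
    have du: "(u has_derivative (\<lambda>v. g x \<bullet> v)) (at x)" using u x by (simp add: C1_bar_grad_def)
    have dJ: "((\<lambda>x. (x, u x, G x)) has_derivative (\<lambda>v. (v, g x \<bullet> v, \<chi> i. dG i x \<bullet> v))) (at x)"
      by (intro has_derivative_Pair has_derivative_ident du dG)
    have dK: "(K has_derivative (\<lambda>v. k (x, u x, G x) \<bullet> v)) (at (x, u x, G x))"
      using K x by (simp add: C1_bar_grad_def)
    have "k (x, u x, G x) \<bullet> (v, g x \<bullet> v, \<chi> i. dG i x \<bullet> v)
      = (fst (k (x, u x, G x)) + fst (snd (k (x, u x, G x))) *\<^sub>R g x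
        + (\<Sum>i\<in>UNIV. snd (snd (k (x, u x, G x))) $ i *\<^sub>R dG i x)) \<bullet> v" for v
      by (cases "k (x, u x, G x)") (simp add: inner_add_left inner_sum_left inner_vec_def[of _ "vec_lambda _"])
    with has_derivative_gradient_compose[where f = K, OF dJ dK] show ?thesis by simp
  qed
  then show ?thesis
    unfolding C1_bar_grad_def
    by (intro conjI ballI cK continuous_on_add continuous_on_sum continuous_on_scaleR continuous_on_fst
        continuous_on_snd continuous_on_component ck cu cdG) auto
qed

section \<open>The Pohozaev-type identity\<close>

theorem theorem3p5:
  fixes X :: "'m::finite \<Rightarrow> 'n::{finite,linorder} vfield"
    and \<sigma> :: "'n \<Rightarrow> nat"
    and \<Omega> :: "(real^'n::{finite,linorder}) set"
    and \<nu> :: "real^'n::{finite,linorder} \<Rightarrow> real^'n::{finite,linorder}"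
    and F :: "(real^'n::{finite,linorder}) \<times> real \<times> (real^'m::finite) \<Rightarrow> real"
    and u :: "real^'n::{finite,linorder} \<Rightarrow> real"
  defines "q \<equiv> (\<Sum>j\<in>UNIV. real (\<sigma> j))"
    and "J \<equiv> jet X \<Omega> u"
    and "Xu \<equiv> bar_ext \<Omega> (X_grad X u)"
    and "Tu \<equiv> bar_ext \<Omega> (vf_app (T_field \<sigma>) u)"
    and "\<nu>X \<equiv> (\<lambda>x. \<chi> i. X i x \<bullet> \<nu> x)"
  assumes "\<forall>i. smooth (X i)"
    and "lin_indep_fields X"
    and "dil_weights \<sigma>"
    and "\<forall>i. homogeneous_deg1 \<sigma> (X i)"
    and "hoermander_at_0 X"
    and "open \<Omega>" and "bounded \<Omega>"
    and "divergence_regular \<Omega> \<nu>"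
    and "P1 \<Omega> F" and "P2 \<Omega> F"
    and "Ck_bar 2 \<Omega> u"
    and "\<forall>x\<in>\<Omega>. X_div X (\<lambda>y. D_p F (J y)) x + D_z F (J x) = 0"
  shows
    "(LINT x:\<Omega>|lborel. q * F (J x) - D_p F (J x) \<bullet> Xu x)
       + (LINT x:\<Omega>|lborel. \<Sum>j\<in>UNIV. real (\<sigma> j) * x $ j * D_x F j (J x))
     = (LINT x:frontier \<Omega>|surf. F (J x) * (T_field \<sigma> x \<bullet> \<nu> x))
       - (LINT x:frontier \<Omega>|surf. Tu x * (D_p F (J x) \<bullet> \<nu>X x))
     \<and> ((\<forall>x\<in>frontier \<Omega>. u x = 0) \<longrightarrow> (\<forall>a::real.
         (LINT x:\<Omega>|lborel. q * F (J x) - (a + 1) * (D_p F (J x) \<bullet> Xu x))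
           + (LINT x:\<Omega>|lborel. \<Sum>j\<in>UNIV. real (\<sigma> j) * x $ j * D_x F j (J x))
           - a * (LINT x:\<Omega>|lborel. u x * D_z F (J x))
         = (LINT x:frontier \<Omega>|surf.
              (F (J x) - D_p F (J x) \<bullet> Xu x) * (T_field \<sigma> x \<bullet> \<nu> x))))"
proof -
  have fc: "x \<in> closure \<Omega>" if "x \<in> frontier \<Omega>" for x using that by (simp add: frontier_def)
  have \<Omega>c: "x \<in> closure \<Omega>" if "x \<in> \<Omega>" for x using that closure_subset by blast
  have "\<forall>i. \<exists>A. \<forall>k. C1_bar_grad UNIV (\<lambda>x. X i x $ k) (A k)"
    using assms(6) smooth_imp_C1_bar_grad by blast
  then obtain A where A: "\<And>i k. C1_bar_grad UNIV (\<lambda>x. X i x $ k) (A i k)"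
    by metis
  have A\<Omega>: "C1_bar_grad \<Omega> (\<lambda>x. X i x $ k) (A i k)" for i k
    using C1_bar_grad_subset[OF A] by simp
  obtain g h where u: "C1_bar_grad \<Omega> u g" and h: "\<And>l. C1_bar_grad \<Omega> (\<lambda>x. g x $ l) (h l)"
    using Ck_bar_2_imp_C1_bar_grad[OF assms(16)] by blast
  define dXu where "dXu i x = (\<Sum>k\<in>UNIV. X i x $ k *\<^sub>R h k x + g x $ k *\<^sub>R A i k x)" for i x
  have dXu: "C1_bar_grad \<Omega> (\<lambda>x. X i x \<bullet> g x) (dXu i)" for i
    unfolding dXu_def inner_vec_def inner_real_def
    by (intro C1_bar_grad_sum finite C1_bar_grad_mult h A\<Omega>)
  define G where "G x = (\<chi> i. X i x \<bullet> g x)" for x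
  have G: "C1_bar_grad \<Omega> (\<lambda>x. G x $ i) (dXu i)" for i
    using dXu by (simp add: G_def)
  have cG: "continuous_on (closure \<Omega>) G"
    unfolding G_def using dXu by (intro continuous_on_vec_lambda) (simp add: C1_bar_grad_def)
  \<comment> \<open>On the closure, the limits that define \<open>Xu\<close>, \<open>Tu\<close> and \<open>J\<close> on the boundary are given by the
    same formulas as in \<open>\<Omega>\<close>, with \<open>g\<close> as the gradient of \<open>u\<close>.\<close>
  have Xu: "Xu x = G x" if "x \<in> closure \<Omega>" for x
    unfolding Xu_def
    by (rule bar_ext_eq[OF cG _ that]) (simp add: X_grad_def G_def vf_app_eq_inner[OF u] inner_commute)
  have "continuous_on (closure \<Omega>) (\<lambda>x. g x \<bullet> T_field \<sigma> x)"
    unfolding T_field_def using u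
    by (intro continuous_on_inner continuous_on_vec_lambda continuous_intros) (simp add: C1_bar_grad_def)
  then have Tu: "Tu x = g x \<bullet> T_field \<sigma> x" if "x \<in> closure \<Omega>" for x
    unfolding Tu_def by (rule bar_ext_eq[OF _ _ that]) (simp add: vf_app_eq_inner[OF u])
  have J: "J x = (x, u x, G x)" if "x \<in> closure \<Omega>" for x
    using Xu[OF that] by (simp add: J_def jet_def Xu_def)

  define p where "p x = D_p F (J x)" for x
  define fx where "fx x = (\<chi> j. D_x F j (J x))" for x
  define fz where "fz x = D_z F (J x)" for x
  define Y where "Y x = (\<Sum>i\<in>UNIV. p x $ i *\<^sub>R X i x)" for x
  note FF = integrand_C1_bar_grad[OF assms(14)]
  have \<Phi>: "C1_bar_grad \<Omega> (\<lambda>x. F (J x)) (\<lambda>x. fx x + fz x *\<^sub>R g x + (\<Sum>i\<in>UNIV. p x $ i *\<^sub>R dXu i x))"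
    by (rule C1_bar_grad_cong[OF assms(11) C1_bar_grad_compose_jet[OF FF u G]])
       (simp_all add: J fx_def fz_def p_def)
  have "\<exists>P. C1_bar_grad \<Omega> (\<lambda>x. p x $ i) P" for i
  proof -
    have "Ck_bar 1 (\<Omega> \<times> UNIV \<times> UNIV) (\<lambda>w. D_p F w $ i)"
      using assms(15) unfolding P2_def by blast
    from C1_bar_grad_compose_jet[OF Ck_bar_1_imp_C1_bar_grad[OF this] u G]
    obtain P where "C1_bar_grad \<Omega> (\<lambda>x. D_p F (x, u x, G x) $ i) P" by blast
    then have "C1_bar_grad \<Omega> (\<lambda>x. p x $ i) P"
      by (rule C1_bar_grad_cong[OF assms(11)]) (simp_all add: J p_def)
    then show ?thesis by blast
  qed
  then obtain P where P: "\<And>i. C1_bar_grad \<Omega> (\<lambda>x. p x $ i) (P i)" by metis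
  have cJ: "continuous_on (closure \<Omega>) (\<lambda>x. (\<chi> j. D_x F j (J x), D_z F (J x), D_p F (J x)))"
  proof (rule continuous_on_compose2[where f = J])
    show "continuous_on (closure (\<Omega> \<times> UNIV \<times> UNIV)) (\<lambda>w. (\<chi> j. D_x F j w, D_z F w, D_p F w))"
      using FF by (simp add: C1_bar_grad_def)
    have "continuous_on (closure \<Omega>) (\<lambda>x. (x, u x, G x))"
      using u cG by (intro continuous_intros) (simp_all add: C1_bar_grad_def)
    then show "continuous_on (closure \<Omega>) J" by (simp add: J cong: continuous_on_cong)
    show "J ` closure \<Omega> \<subseteq> closure (\<Omega> \<times> UNIV \<times> UNIV)"
      by (auto simp: J closure_Times)
  qed
  have cfx: "continuous_on (closure \<Omega>) fx" and cfz: "continuous_on (closure \<Omega>) fz"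
    using continuous_on_fst[OF cJ] continuous_on_fst[OF continuous_on_snd[OF cJ]]
    by (simp_all add: fx_def[abs_def] fz_def[abs_def])
  have euler: "fz x = (\<Sum>i\<in>UNIV. P i x \<bullet> X i x)" if "x \<in> \<Omega>" for x
    using assms(17) that vf_app_eq_inner[OF P that]
    by (auto simp: X_div_def fz_def p_def)

  have e1: "D_p F (J x) \<bullet> Xu x = g x \<bullet> Y x" if "x \<in> closure \<Omega>" for x
    by (simp add: Xu[OF that] G_def Y_def p_def inner_sum_right inner_vec_def[of _ "vec_lambda _"] inner_commute)
  have e2: "(\<Sum>j\<in>UNIV. real (\<sigma> j) * x $ j * D_x F j (J x)) = T_field \<sigma> x \<bullet> fx x" for x
    by (simp add: T_field_def fx_def inner_vec_def)
  have e3: "D_p F (J x) \<bullet> \<nu>X x = Y x \<bullet> \<nu> x" for x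
    by (simp add: \<nu>X_def Y_def p_def inner_sum_left inner_vec_def[of _ "vec_lambda _"])
  have i1: "(LINT x:\<Omega>|lborel. q * F (J x) - D_p F (J x) \<bullet> Xu x) = (LINT x:\<Omega>|lborel. q * F (J x) - g x \<bullet> Y x)"
    by (rule set_integral_cong_pointwise) (simp add: e1 \<Omega>c)
  have i2: "(LINT x:\<Omega>|lborel. q * F (J x) - (a + 1) * (D_p F (J x) \<bullet> Xu x)) = (LINT x:\<Omega>|lborel. q * F (J x) - (a + 1) * (g x \<bullet> Y x))" for a
    by (rule set_integral_cong_pointwise) (simp add: e1 \<Omega>c)
  have i3: "(LINT x:frontier \<Omega>|surf. Tu x * (D_p F (J x) \<bullet> \<nu>X x)) = (LINT x:frontier \<Omega>|surf. (g x \<bullet> T_field \<sigma> x) * (Y x \<bullet> \<nu> x))"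
    by (rule set_integral_cong_pointwise) (simp add: Tu fc e3)
  have i4: "(LINT x:frontier \<Omega>|surf. (F (J x) - D_p F (J x) \<bullet> Xu x) * (T_field \<sigma> x \<bullet> \<nu> x))
      = (LINT x:frontier \<Omega>|surf. (F (J x) - g x \<bullet> Y x) * (T_field \<sigma> x \<bullet> \<nu> x))"
    by (rule set_integral_cong_pointwise) (simp add: e1 fc)
  have hom: "\<And>i. homogeneous_deg1 \<sigma> (X i)" using assms(9) by blast
  note core = pohozaev_core[OF assms(11-13) A hom u h dXu \<Phi> cfx cfz P euler]
  have free: "(LINT x:\<Omega>|lborel. q * F (J x) - g x \<bullet> Y x) + (LINT x:\<Omega>|lborel. T_field \<sigma> x \<bullet> fx x)
      = (LINT x:frontier \<Omega>|surf. F (J x) * (T_field \<sigma> x \<bullet> \<nu> x))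
       - (LINT x:frontier \<Omega>|surf. (g x \<bullet> T_field \<sigma> x) * (Y x \<bullet> \<nu> x))"
    unfolding q_def Y_def by (rule core(1))
  have dirichlet: "(LINT x:\<Omega>|lborel. q * F (J x) - (a + 1) * (g x \<bullet> Y x))
       + (LINT x:\<Omega>|lborel. T_field \<sigma> x \<bullet> fx x) - a * (LINT x:\<Omega>|lborel. u x * fz x)
      = (LINT x:frontier \<Omega>|surf. (F (J x) - g x \<bullet> Y x) * (T_field \<sigma> x \<bullet> \<nu> x))"
    if "\<forall>x\<in>frontier \<Omega>. u x = 0" for a
    unfolding q_def Y_def by (rule core(2)) (simp_all add: that)
  show ?thesis
    unfolding i1 i2 i3 i4 e2 fz_def[symmetric]
    by (intro conjI impI allI free dirichlet)
qed

end
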